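(* Let $(T,\Sigma,\mu)$ be a complete saturated finite measure space, let $E$ be a separable real Banach space with norm dual $E^*$, and let $W$ be a nonempty weakly$^*$ closed subset of $E^*$. Then for every economy $\mathcal{E}=\{(T,\Sigma,\mu),X,\succsim,\omega\}$ such that (i) $X$ is a weakly$^*$ compact subset of $E^*$, (ii) ${\succsim}(t)$ is a weakly$^*$ closed subset of $X\times X$ for every $t\in T$, (iii) for every $x,y\in X$ the set $\{t\in T: x\,{\succ}(t)\,y\}$ is in $\Sigma$, the set $\mathcal{P}(\mathcal{E})$ of Pareto optimal allocations for $\mathcal{E}$ is nonempty.
   Context: A finite measure space $(T,\Sigma,\mu)$ is saturated if for every $S\in\Sigma$ with $\mu(S)>0$ the space $L^1_S(\mu)$ of $\mu$-integrable functions on $(S,\Sigma_S)$, $\Sigma_S=\{A\cap S: A\in\Sigma\}$, is nonseparable. A function $f:T\to E^*$ is Gelfand integrable if $\langle f(\cdot),x\rangle$ is integrable for every $x\in E$; its Gelfand integral $\int_Tf\,d\mu\in E^*$ is the element with $\langle\int_T f\,d\mu,x\rangle=\int_T\langle f(t),x\rangle d\mu$ for all $x\in E$ (all $E^*$-valued integrals are understood this way). $G^1(\mu,E^* )$ is the space of (classes of) Gelfand integrable functions. An economy $\mathcal{E}=\{(T,\Sigma,\mu),X,\succsim,\omega\}$ consists of: the space of agents $(T,\Sigma,\mu)$; a common consumption set $X\subset E^*$; for each $t\in T$ a complete, transitive binary relation ${\succsim}(t)\subset X\times X$, with $x\,{\succsim}(t)\,y$ meaning $(x,y)\in{\succsim}(t)$,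 and strict part $x\,{\succ}(t)\,y$ meaning $x\,{\succsim}(t)\,y$ and not $y\,{\succsim}(t)\,x$; and a Gelfand integrable $\omega:T\to E^*$ with $\omega(t)\in X$ for all $t$ (initial endowments). An allocation for $\mathcal{E}$ (relative to $W$) is $f\in G^1(\mu,E^* )$ with $\int_Tf\,d\mu-\int_T\omega\,d\mu\in W$ and $f(t)\in X$ a.e. $t\in T$; the set of allocations is $\mathcal{A}(\mathcal{E})$. An allocation $f\in\mathcal{A}(\mathcal{E})$ is Pareto optimal for $\mathcal{E}$ if there exist no $g\in\mathcal{A}(\mathcal{E})$ and $A\in\Sigma$ with $\mu(A)>0$ such that $g(t)\,{\succsim}(t)\,f(t)$ a.e. $t\in T$ and $g(t)\,{\succ}(t)\,f(t)$ for every $t\in A$.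
   Formalization: The set of allocations A(E) is additionally assumed nonempty; without this the claim fails, e.g. X={0}, ω=0, W={w} with w≠0 satisfies (i)-(iii) but has no allocation. *)

theory Defs
  imports "HOL-Analysis.Analysis"
begin

text \<open>The norm dual of \<open>E\<close> is the type of bounded linear functionals \<open>E \<Rightarrow>\<^sub>L real\<close>.
  For real-valued operators, the strong operator topology (pointwise convergence on \<open>E\<close>) is
  the weak* topology.\<close>

abbreviation weak_star :: "('e::real_normed_vector \<Rightarrow>\<^sub>L real) topology" where
  "weak_star \<equiv> strong_operator_topology"

text \<open>Separability of \<open>L\<^sup>1\<close> is expressed on representatives, with the \<open>L\<^sup>1\<close>-seminorm; this is
  separability of the normed space of equivalence classes.\<close>

definition L1_separable :: "'a measure \<Rightarrow> bool" where
  "L1_separable N \<longleftrightarrow>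
     (\<exists>D :: ('a \<Rightarrow> real) set. countable D \<and> (\<forall>d\<in>D. integrable N d) \<and>
        (\<forall>f. integrable N f \<longrightarrow> (\<forall>e>0. \<exists>d\<in>D. (\<integral>t. \<bar>f t - d t\<bar> \<partial>N) < e)))"

definition saturated_measure :: "'a measure \<Rightarrow> bool" where
  "saturated_measure M \<longleftrightarrow>
     finite_measure M \<and>
     (\<forall>S\<in>sets M. measure M S > 0 \<longrightarrow> \<not> L1_separable (restrict_space M S))"

definition gelfand_integrable ::
    "'a measure \<Rightarrow> ('a \<Rightarrow> 'e::banach \<Rightarrow>\<^sub>L real) \<Rightarrow> bool" where
  "gelfand_integrable M f \<longleftrightarrow> (\<forall>x. integrable M (\<lambda>t. blinfun_apply (f t) x))"

definition gelfand_integral ::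
    "'a measure \<Rightarrow> ('a \<Rightarrow> 'e::banach \<Rightarrow>\<^sub>L real) \<Rightarrow> ('e \<Rightarrow>\<^sub>L real)" where
  "gelfand_integral M f =
     (THE I. \<forall>x. blinfun_apply I x = (\<integral>t. blinfun_apply (f t) x \<partial>M))"

text \<open>The description defining the Gelfand integral is proper for every Gelfand integrable
  function, by a Baire category argument.\<close>

lemma gelfand_integral_exists:
  fixes f :: "'a \<Rightarrow> 'e::banach \<Rightarrow>\<^sub>L real"
  assumes f: "gelfand_integrable M f"
  shows "\<exists>I. \<forall>x. blinfun_apply I x = (\<integral>t. blinfun_apply (f t) x \<partial>M)"
proof -
  have int: "integrable M (\<lambda>t. blinfun_apply (f t) x)" for x
    using f by (simp add: gelfand_integrable_def)
  have meas [measurable]: "(\<lambda>t. blinfun_apply (f t) x) \<in> borel_measurable M" for x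
    using int by blast
  define p where "p x = (\<integral>t. \<bar>blinfun_apply (f t) x\<bar> \<partial>M)" for x
  have nn: "(\<integral>\<^sup>+t. ennreal \<bar>blinfun_apply (f t) x\<bar> \<partial>M) = ennreal (p x)" for x
    unfolding p_def by (rule nn_integral_eq_integral) (use int in auto)
  have p_nonneg: "p x \<ge> 0" for x
    unfolding p_def by simp
  define A where "A n = {x. p x \<le> real n}" for n
  have closed_A: "closed (A n)" for n
    unfolding closed_sequential_limits
  proof (intro allI impI)
    fix u l
    assume u: "(\<forall>k. u k \<in> A n) \<and> u \<longlonglongrightarrow> l"
    have "(\<lambda>k. ennreal \<bar>blinfun_apply (f t) (u k)\<bar>) \<longlonglongrightarrow> ennreal \<bar>blinfun_apply (f t) l\<bar>" for t
      using u by (intro tendsto_intros) auto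
    then have "ennreal \<bar>blinfun_apply (f t) l\<bar>
        = liminf (\<lambda>k. ennreal \<bar>blinfun_apply (f t) (u k)\<bar>)" for t
      by (metis lim_imp_Liminf sequentially_bot)
    then have "ennreal (p l)
        = (\<integral>\<^sup>+t. liminf (\<lambda>k. ennreal \<bar>blinfun_apply (f t) (u k)\<bar>) \<partial>M)"
      by (simp flip: nn)
    also have "\<dots> \<le> liminf (\<lambda>k. \<integral>\<^sup>+t. ennreal \<bar>blinfun_apply (f t) (u k)\<bar> \<partial>M)"
      by (rule nn_integral_liminf) measurable
    also have "\<dots> \<le> liminf (\<lambda>k::nat. ennreal (real n))"
      using u by (intro Liminf_mono always_eventually allI) (auto simp: nn A_def intro!: ennreal_leI)
    also have "\<dots> = ennreal (real n)"
      by (simp add: Liminf_const)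
    finally show "l \<in> A n"
      by (simp add: A_def ennreal_le_iff)
  qed
  have "\<exists>n. interior (A n) \<noteq> {}"
  proof (rule ccontr)
    assume "\<not> ?thesis"
    then have emp: "interior (A n) = {}" for n
      by simp
    have "euclidean interior_of \<Union>(range A) = {}"
      by (rule Baire_category_alt)
        (use closed_A emp in \<open>auto simp: completely_metrizable_space_euclidean\<close>)
    moreover have "\<Union>(range A) = UNIV"
      unfolding A_def using real_arch_simple by auto
    ultimately show False
      by simp
  qed
  then obtain n c r where r: "r > 0" "ball c r \<subseteq> A n"
    by (metis ex_in_conv mem_interior)
  have p_ball: "p y \<le> 2 * real n" if "norm y < r" for y
  proof -
    have "p y \<le> (\<integral>t. \<bar>blinfun_apply (f t) (c + y)\<bar> + \<bar>blinfun_apply (f t) c\<bar> \<partial>M)"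
      unfolding p_def
      by (intro integral_mono Bochner_Integration.integrable_add integrable_abs int)
        (simp add: blinfun.add_right)
    also have "\<dots> = p (c + y) + p c"
      unfolding p_def by (intro Bochner_Integration.integral_add integrable_abs int)
    also have "\<dots> \<le> real n + real n"
      using r that by (intro add_mono) (auto simp: A_def subset_iff dist_norm)
    finally show ?thesis by simp
  qed
  define L where "L x = (\<integral>t. blinfun_apply (f t) x \<partial>M)" for x
  have L_p: "\<bar>L x\<bar> \<le> p x" for x
    unfolding L_def p_def by (rule integral_abs_bound)
  have L_scale: "L (a *\<^sub>R x) = a * L x" for a x
    unfolding L_def by (simp add: blinfun.scaleR_right)
  have "bounded_linear L"
  proof (rule bounded_linear_intro)
    show "L (x + y) = L x + L y" for x y
      unfolding L_def by (simp add: blinfun.add_right int)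
    show "L (a *\<^sub>R x) = a *\<^sub>R L x" for a x
      by (simp add: L_scale)
    show "norm (L x) \<le> norm x * (4 * real n / r)" for x
    proof (cases "x = 0")
      case True
      then show ?thesis using L_scale[of 0 x] by simp
    next
      case False
      define a where "a = r / (2 * norm x)"
      have a: "a > 0" using False r by (simp add: a_def)
      have "norm (a *\<^sub>R x) < r" using False r by (simp add: a_def)
      then have "a * \<bar>L x\<bar> \<le> 2 * real n"
        using p_ball[of "a *\<^sub>R x"] L_p[of "a *\<^sub>R x"] a by (simp add: L_scale abs_mult)
      then show ?thesis
        using False r by (simp add: a_def field_simps)
    qed
  qed
  then have "\<forall>x. blinfun_apply (Blinfun L) x = L x"
    by (simp add: bounded_linear_Blinfun_apply)
  then show ?thesis
    unfolding L_def by blast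
qed

lemma gelfand_integral_apply:
  assumes "gelfand_integrable M f"
  shows "blinfun_apply (gelfand_integral M f) x = (\<integral>t. blinfun_apply (f t) x \<partial>M)"
proof -
  have "\<exists>!I. \<forall>x. blinfun_apply I x = (\<integral>t. blinfun_apply (f t) x \<partial>M)"
    using gelfand_integral_exists[OF assms] by (metis blinfun_eqI)
  from theI'[OF this] show ?thesis
    unfolding gelfand_integral_def by blast
qed

definition strictly_prefers :: "('b \<times> 'b) set \<Rightarrow> 'b \<Rightarrow> 'b \<Rightarrow> bool" where
  "strictly_prefers R x y \<longleftrightarrow> (x, y) \<in> R \<and> (y, x) \<notin> R"

text \<open>The set \<open>T\<close> of agents is \<open>space M\<close>; values of \<open>pref\<close> and \<open>\<omega>\<close> outside it are irrelevant.
  Completeness includes reflexivity on \<open>X\<close>, which \<open>total_on\<close> would not give.\<close>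

definition economy ::
    "'a measure \<Rightarrow> ('e::banach \<Rightarrow>\<^sub>L real) set \<Rightarrow>
     ('a \<Rightarrow> (('e \<Rightarrow>\<^sub>L real) \<times> ('e \<Rightarrow>\<^sub>L real)) set) \<Rightarrow> ('a \<Rightarrow> 'e \<Rightarrow>\<^sub>L real) \<Rightarrow> bool" where
  "economy M X pref \<omega> \<longleftrightarrow>
     (\<forall>t\<in>space M. pref t \<subseteq> X \<times> X \<and>
        (\<forall>x\<in>X. \<forall>y\<in>X. (x, y) \<in> pref t \<or> (y, x) \<in> pref t) \<and> trans (pref t)) \<and>
     gelfand_integrable M \<omega> \<and> (\<forall>t\<in>space M. \<omega> t \<in> X)"

text \<open>Elements of \<open>G\<^sup>1(\<mu>, E\<^sup>*)\<close> are handled through representatives; all conditions below are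
  insensitive to changes on a null set (in Pareto optimality, after shrinking \<open>A\<close> by that null
  set).\<close>

definition allocations ::
    "'a measure \<Rightarrow> ('e::banach \<Rightarrow>\<^sub>L real) set \<Rightarrow> ('e \<Rightarrow>\<^sub>L real) set \<Rightarrow>
     ('a \<Rightarrow> 'e \<Rightarrow>\<^sub>L real) \<Rightarrow> ('a \<Rightarrow> 'e \<Rightarrow>\<^sub>L real) set" where
  "allocations M W X \<omega> =
     {f. gelfand_integrable M f \<and>
         gelfand_integral M f - gelfand_integral M \<omega> \<in> W \<and>
         (AE t in M. f t \<in> X)}"

definition pareto_optimal_allocations ::
    "'a measure \<Rightarrow> ('e::banach \<Rightarrow>\<^sub>L real) set \<Rightarrow> ('e \<Rightarrow>\<^sub>L real) set \<Rightarrow>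
     ('a \<Rightarrow> (('e \<Rightarrow>\<^sub>L real) \<times> ('e \<Rightarrow>\<^sub>L real)) set) \<Rightarrow> ('a \<Rightarrow> 'e \<Rightarrow>\<^sub>L real) \<Rightarrow>
     ('a \<Rightarrow> 'e \<Rightarrow>\<^sub>L real) set" where
  "pareto_optimal_allocations M W X pref \<omega> =
     {f \<in> allocations M W X \<omega>.
        \<not> (\<exists>g \<in> allocations M W X \<omega>. \<exists>A \<in> sets M. measure M A > 0 \<and>
             (AE t in M. (g t, f t) \<in> pref t) \<and>
             (\<forall>t\<in>A. strictly_prefers (pref t) (g t) (f t)))}"

text \<open>If \<open>0 \<in> W\<close> then the endowment is an allocation. If \<open>0 \<notin> W\<close> there may be no allocation at
  all, hence no Pareto optimal one, however regular the economy is.\<close>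

lemma endowment_allocation:
  assumes "economy M X pref \<omega>" "0 \<in> W"
  shows "\<omega> \<in> allocations M W X \<omega>"
  using assms by (auto simp: economy_def allocations_def)

lemma allocations_empty:
  fixes W :: "('e::banach \<Rightarrow>\<^sub>L real) set"
  assumes "0 \<notin> W"
  shows "economy M {0} (\<lambda>_. {(0, 0)}) (\<lambda>_. 0 :: 'e \<Rightarrow>\<^sub>L real)"
    and "allocations M W {0} (\<lambda>_. 0) = {}"
proof -
  have z: "gelfand_integrable M (\<lambda>_. 0 :: 'e \<Rightarrow>\<^sub>L real)"
    by (simp add: gelfand_integrable_def)
  then show "economy M {0} (\<lambda>_. {(0, 0)}) (\<lambda>_. 0 :: 'e \<Rightarrow>\<^sub>L real)"
    by (auto simp: economy_def trans_def)
  have "gelfand_integral M f = gelfand_integral M (\<lambda>_. 0)"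
    if "gelfand_integrable M f" "AE t in M. f t \<in> {0}" for f :: "'a \<Rightarrow> 'e \<Rightarrow>\<^sub>L real"
  proof (rule blinfun_eqI)
    fix x
    have "(\<integral>t. blinfun_apply (f t) x \<partial>M) = (\<integral>t. blinfun_apply 0 x \<partial>M)"
      using that by (intro integral_cong_AE) (auto simp: gelfand_integrable_def)
    then show "blinfun_apply (gelfand_integral M f) x
        = blinfun_apply (gelfand_integral M (\<lambda>_. 0)) x"
      by (simp only: gelfand_integral_apply[OF that(1)] gelfand_integral_apply[OF z])
  qed
  then show "allocations M W {0} (\<lambda>_. 0) = {}"
    using assms by (force simp: allocations_def)
qed

end

(* Utility functions are avoided: under (iii) the preferences need not admit a utility that is
   jointly measurable, so allocations are compared by the preorder "g(t) weakly preferred to f(t)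
   for almost all t" instead.

   Countable chains of allocations have upper bounds.  For a chain (f_n) one finds an allocation f
   such that f(t) is a weak* cluster point of f_n(t) for almost all t and the integral of f is a limit
   point of the integrals of f_n; closedness of the preferences and of W does the rest.  Here
   saturation enters: the limiting conditional distributions of f_n, given the countably generated
   sigma-algebra they generate, must be realised by a genuine function.

   A maximal element is then reached by stabilising countably many bounded monotone functionals
   along such chains (as in the Brezis-Browder principle). *)

theory Submission
  imports Defs
begin

subsection \<open>Ordering principles\<close>

text \<open>The obstacle to maximality is measurability: the set of agents at which one measurable
  selection is strictly preferred to another is not known to be measurable. The functionals
  therefore measure sets of agents for whom the measurable relation \<open>above\<close> holds. It
  can overlook an improvement that crosses fewer than two intermediate indifference classes, so
  freezing it does not yet give a maximal element. Two further maximisations, of an inner measure of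
  the set of strict improvement, force any remaining improvement to end a chain of strict steps long
  enough for \<open>above\<close> to see.

  Bounding a chain needs more than convergence in distribution. Clustering at almost every agent
  concerns the joint behaviour of all \<open>f n\<close> at one agent, and is obtained by matching
  distributions conditionally on the sigma-algebra generated by the whole sequence. Separability of
  the Banach space turns \<open>X\<close> into a compact metrizable set, in which countably many
  sets describe positions.\<close>

lemma le_if_le_add_inverse_Suc:
  fixes a b :: real
  assumes "\<And>n. a \<le> b + 1 / real (Suc n)"
  shows "a \<le> b"
proof (rule field_le_epsilon)
  fix e :: real assume "e > 0"
  then obtain n where "1 / real (Suc n) < e"
    using nat_approx_posE by blast
  then show "a \<le> b + e"
    using assms[of n] by linarith
qed

text \<open>Each step of a chain comes within \<open>1 / Suc n\<close> of \<open>S\<close>, the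
  supremum of \<phi> over what lies above; hence \<phi> cannot grow beyond an upper bound
  \<open>u\<close> of the chain.\<close>

lemma ordering_principle:
  fixes \<phi> :: "'c \<Rightarrow> real"
  assumes trans: "\<And>x y z. le x y \<Longrightarrow> le y z \<Longrightarrow> le x z"
    and refl: "\<And>x. x \<in> A \<Longrightarrow> le x x"
    and chain: "\<And>s :: nat \<Rightarrow> 'c. (\<And>n. s n \<in> A) \<Longrightarrow> (\<And>n. le (s n) (s (Suc n))) \<Longrightarrow> \<exists>u\<in>A. \<forall>n. le (s n) u"
    and mono: "\<And>x y. x \<in> A \<Longrightarrow> y \<in> A \<Longrightarrow> le x y \<Longrightarrow> \<phi> x \<le> \<phi> y"
    and bdd: "bdd_above (\<phi> ` A)"
    and x: "x \<in> A"
  shows "\<exists>y\<in>A. le x y \<and> (\<forall>z\<in>A. le y z \<longrightarrow> \<phi> z = \<phi> y)"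
proof -
  define S where "S y = (SUP z\<in>{z\<in>A. le y z}. \<phi> z)" for y
  have bdd': "bdd_above (\<phi> ` {z\<in>A. le y z})" for y
    using bdd by (rule bdd_above_mono) auto
  have step: "\<exists>z. z \<in> A \<and> le y z \<and> S y - 1 / Suc n \<le> \<phi> z" if "y \<in> A" for y n
  proof -
    have "\<exists>z\<in>{z\<in>A. le y z}. S y - 1 / Suc n < \<phi> z"
      unfolding S_def by (subst less_cSUP_iff[symmetric]) (use that refl bdd' in auto)
    then show ?thesis by force
  qed
  have "\<exists>s. \<forall>n. (s n \<in> A \<and> (n = 0 \<longrightarrow> s n = x)) \<and>
      le (s n) (s (Suc n)) \<and> S (s n) - 1 / Suc n \<le> \<phi> (s (Suc n))"
    by (rule dependent_nat_choice) (use x step in auto)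
  then obtain s where s: "s 0 = x" "\<And>n. s n \<in> A" "\<And>n. le (s n) (s (Suc n))"
    "\<And>n. S (s n) - 1 / Suc n \<le> \<phi> (s (Suc n))"
    by blast
  from chain[of s] s obtain u where u: "u \<in> A" "\<And>n. le (s n) u"
    by blast
  have "\<phi> z = \<phi> u" if z: "z \<in> A" "le u z" for z
  proof (rule antisym)
    have "\<phi> z \<le> \<phi> u + 1 / Suc n" for n
    proof -
      have "le (s n) z"
        using trans[of "s n" u z] z u by blast
      then have "\<phi> z \<le> S (s n)"
        unfolding S_def using z bdd' by (intro cSUP_upper) auto
      also have "\<dots> \<le> \<phi> (s (Suc n)) + 1 / Suc n"
        using s(4)[of n] by simp
      also have "\<phi> (s (Suc n)) \<le> \<phi> u"
        using mono u s by blast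
      finally show ?thesis by simp
    qed
    then show "\<phi> z \<le> \<phi> u"
      by (rule le_if_le_add_inverse_Suc)
    show "\<phi> u \<le> \<phi> z" using mono u z by blast
  qed
  then show ?thesis using u s(1) by blast
qed

text \<open>A chain is built whose member \<open>s (Suc n)\<close> freezes \<open>\<phi> n\<close>;
  an upper bound lies above all members and inherits all frozen values at once.\<close>

lemma ordering_principle_countable:
  fixes \<phi> :: "nat \<Rightarrow> 'c \<Rightarrow> real"
  assumes trans: "\<And>x y z. le x y \<Longrightarrow> le y z \<Longrightarrow> le x z"
    and refl: "\<And>x. x \<in> A \<Longrightarrow> le x x"
    and chain: "\<And>s :: nat \<Rightarrow> 'c. (\<And>n. s n \<in> A) \<Longrightarrow> (\<And>n. le (s n) (s (Suc n))) \<Longrightarrow> \<exists>u\<in>A. \<forall>n. le (s n) u"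
    and mono: "\<And>n x y. x \<in> A \<Longrightarrow> y \<in> A \<Longrightarrow> le x y \<Longrightarrow> \<phi> n x \<le> \<phi> n y"
    and bdd: "\<And>n. bdd_above (\<phi> n ` A)"
    and x: "x \<in> A"
  shows "\<exists>y\<in>A. le x y \<and> (\<forall>z\<in>A. le y z \<longrightarrow> (\<forall>n. \<phi> n z = \<phi> n y))"
proof -
  have step: "\<exists>y\<in>A. le x y \<and> (\<forall>z\<in>A. le y z \<longrightarrow> \<phi> n z = \<phi> n y)" if "x \<in> A" for x n
    by (rule ordering_principle[OF trans refl chain mono bdd that])
  have "\<exists>s. \<forall>n. (s n \<in> A \<and> (n = 0 \<longrightarrow> s n = x)) \<and>
      le (s n) (s (Suc n)) \<and> (\<forall>z\<in>A. le (s (Suc n)) z \<longrightarrow> \<phi> n z = \<phi> n (s (Suc n)))"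
  proof (rule dependent_nat_choice)
    show "\<exists>z. (z \<in> A \<and> (Suc n = 0 \<longrightarrow> z = x)) \<and> le y z \<and> (\<forall>w\<in>A. le z w \<longrightarrow> \<phi> n w = \<phi> n z)"
      if "y \<in> A \<and> (n = 0 \<longrightarrow> y = x)" for y n
      using step[of y n] that by blast
  qed (use x in auto)
  then obtain s where s: "s 0 = x" "\<And>n. s n \<in> A" "\<And>n. le (s n) (s (Suc n))"
    "\<And>n z. z \<in> A \<Longrightarrow> le (s (Suc n)) z \<Longrightarrow> \<phi> n z = \<phi> n (s (Suc n))"
    by blast
  from chain[of s] s obtain u where u: "u \<in> A" "\<And>n. le (s n) u"
    by blast
  have "\<phi> n z = \<phi> n u" if "z \<in> A" "le u z" for z n
    using s(4)[of z n] s(4)[of u n] u trans[of "s (Suc n)" u z] that s(2) by auto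
  then show ?thesis using u s(1) by blast
qed

subsection \<open>Maximal selections for measurable preferences\<close>

text \<open>Measurability in \<open>t\<close> is required for fixed pairs only. For measurable
  \<open>f\<close> and \<open>g\<close> the set of \<open>t\<close> with
  \<open>(g t, f t) \<in> R t\<close> is not known to be in \<open>sets M\<close>, so functions are
  compared through \<open>AE\<close>, which asks only for a null set outside which the comparison
  holds.\<close>

locale measurable_preferences = finite_measure M
  for M :: "'a measure" +
  fixes K :: "'b::{metric_space, second_countable_topology} set"
    and R :: "'a \<Rightarrow> ('b \<times> 'b) set"
  assumes R_closed: "t \<in> space M \<Longrightarrow> closed (R t)"
    and R_complete: "t \<in> space M \<Longrightarrow> x \<in> K \<Longrightarrow> y \<in> K \<Longrightarrow> (x, y) \<in> R t \<or> (y, x) \<in> R t"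
    and R_trans: "t \<in> space M \<Longrightarrow> trans (R t)"
    and R_sets: "x \<in> K \<Longrightarrow> y \<in> K \<Longrightarrow> {t \<in> space M. (x, y) \<in> R t} \<in> sets M"
begin

section \<open>A measurable surrogate for strict preference\<close>

definition base :: "'b set set" where
  "base = (SOME B. countable B \<and> topological_basis B)"

definition dense :: "'b set" where
  "dense = (SOME D. countable D \<and> D \<subseteq> K \<and> K \<subseteq> closure D)"

lemma base: "countable base" "topological_basis base"
  using someI_ex[OF ex_countable_basis] by (auto simp: base_def)

lemma dense: "countable dense" "dense \<subseteq> K" "K \<subseteq> closure dense"
proof -
  have "\<exists>D. countable D \<and> D \<subseteq> K \<and> K \<subseteq> closure D"
    using separable[of K] by metis
  from someI_ex[OF this] show "countable dense" "dense \<subseteq> K" "K \<subseteq> closure dense"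
    by (auto simp: dense_def)
qed

text \<open>A surrogate for \<open>(x, e) \<in> R t\<close> that, for \<open>e\<close> in
  \<open>dense\<close>, consults \<open>R t\<close> at pairs of dense points only. On
  \<open>K\<close> it lies between strict and weak preference of \<open>x\<close> to
  \<open>e\<close>, because strict upper and lower sets are open; on points indifferent to
  \<open>e\<close> it may go either way.\<close>

definition locally_above :: "'a \<Rightarrow> 'b \<Rightarrow> 'b \<Rightarrow> bool" where
  "locally_above t e x \<longleftrightarrow> (\<exists>V\<in>base. x \<in> V \<and> (\<forall>e'\<in>dense \<inter> V. (e', e) \<in> R t))"

text \<open>\<open>above t d x\<close> stands in for the strict preference of \<open>x\<close> to \<open>d\<close>, whose dependence on the pair
  \<open>(t, x)\<close> need not be measurable: preferences may have gaps located at points that depend on \<open>t\<close>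
  in a nonmeasurable way.  \<open>above\<close> is measurable in \<open>(t, x)\<close>, monotone in \<open>x\<close>, and tells \<open>x\<close> from \<open>z\<close>
  as soon as two further indifference classes lie between them.\<close>

definition above :: "'a \<Rightarrow> 'b \<Rightarrow> 'b \<Rightarrow> bool" where
  "above t d x \<longleftrightarrow> (\<exists>e\<in>dense. (d, e) \<notin> R t \<and> locally_above t e x)"

lemma open_better: "t \<in> space M \<Longrightarrow> open {z. (y, z) \<notin> R t}"
  and open_worse: "t \<in> space M \<Longrightarrow> open {z. (z, y) \<notin> R t}"
proof -
  assume t: "t \<in> space M"
  have "closed (Pair y -` R t)" "closed ((\<lambda>z. (z, y)) -` R t)"
    by (intro closed_vimage R_closed t continuous_intros)+
  then show "open {z. (y, z) \<notin> R t}" "open {z. (z, y) \<notin> R t}"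
    by (auto simp: open_closed vimage_def Compl_eq)
qed

lemma dense_witness:
  assumes "open U" "x \<in> U" "x \<in> K"
  obtains d where "d \<in> dense" "d \<in> U"
  using assms dense(3) by (metis closure_iff_nhds_not_empty disjoint_iff order_refl subsetD)

context
  fixes t assumes t: "t \<in> space M"
begin

lemma R_transD: "(x, y) \<in> R t \<Longrightarrow> (y, z) \<in> R t \<Longrightarrow> (x, z) \<in> R t"
  using R_trans[OF t] by (meson transD)

lemma strict_weak: "(y, x) \<notin> R t \<Longrightarrow> x \<in> K \<Longrightarrow> y \<in> K \<Longrightarrow> (x, y) \<in> R t"
  using R_complete t by blast

lemma locally_aboveI:
  assumes "x \<in> K" "e \<in> K" "open U" "x \<in> U" "\<And>e'. e' \<in> dense \<Longrightarrow> e' \<in> U \<Longrightarrow> (e', e) \<in> R t"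
  shows "locally_above t e x"
proof -
  obtain V where "V \<in> base" "x \<in> V" "V \<subseteq> U"
    using topological_basisE[OF base(2) assms(3,4)] by blast
  then show ?thesis
    unfolding locally_above_def using assms(5) by blast
qed

lemma locally_above_strict:
  assumes "x \<in> K" "e \<in> K" "(e, x) \<notin> R t"
  shows "locally_above t e x"
proof (rule locally_aboveI[OF assms(1,2) open_better[OF t, of e]])
  show "x \<in> {z. (e, z) \<notin> R t}" using assms by simp
  show "(e', e) \<in> R t" if "e' \<in> dense" "e' \<in> {z. (e, z) \<notin> R t}" for e'
    using that strict_weak[of e e'] assms dense(2) by blast
qed

lemma locally_above_weak:
  assumes "x \<in> K" "e \<in> K" "locally_above t e x"
  shows "(x, e) \<in> R t"
proof (rule ccontr)
  assume neg: "(x, e) \<notin> R t"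
  obtain V where V: "V \<in> base" "x \<in> V" "\<And>e'. e' \<in> dense \<Longrightarrow> e' \<in> V \<Longrightarrow> (e', e) \<in> R t"
    using assms by (auto simp: locally_above_def)
  have "open (V \<inter> {z. (z, e) \<notin> R t})"
    by (intro open_Int topological_basis_open[OF base(2) V(1)] open_worse[OF t])
  then obtain d where "d \<in> dense" "d \<in> V \<inter> {z. (z, e) \<notin> R t}"
    using dense_witness[of _ x] neg V assms by blast
  then show False using V by blast
qed

lemma above_strict:
  assumes "x \<in> K" "d \<in> K" "above t d x"
  shows "(d, x) \<notin> R t"
  using assms locally_above_weak R_transD dense(2) unfolding above_def by (meson subsetD)

lemma above_between:
  assumes "x \<in> K" "e \<in> dense" "(e, x) \<notin> R t" "(d, e) \<notin> R t"
  shows "above t d x"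
  using assms locally_above_strict dense(2) unfolding above_def by blast

text \<open>The delicate case has \<open>x\<close>, \<open>y\<close> and the witness
  \<open>e\<close> indifferent, as \<open>locally_above\<close> can tell indifferent points apart.
  If no dense point lies strictly between \<open>d\<close> and \<open>e\<close>, the points better
  than \<open>d\<close> form a neighbourhood of \<open>x\<close> that certifies
  \<open>locally_above t e x\<close>; otherwise such a dense point is a witness strictly below
  \<open>x\<close>.\<close>

lemma above_mono:
  assumes "x \<in> K" "y \<in> K" "d \<in> K" "(x, y) \<in> R t" "above t d y"
  shows "above t d x"
proof -
  obtain e where e: "e \<in> dense" "(d, e) \<notin> R t" "locally_above t e y"
    using assms by (auto simp: above_def)
  have ye: "(y, e) \<in> R t"
    using locally_above_weak[OF assms(2) _ e(3)] e dense by auto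
  show ?thesis
  proof (cases "(e, x) \<in> R t")
    case False
    then show ?thesis using above_between assms e by blast
  next
    case True
    have dx: "(d, x) \<notin> R t"
      using True e dense assms(4) ye R_transD by blast
    show ?thesis
    proof (cases "\<forall>e'\<in>dense. (d, e') \<notin> R t \<longrightarrow> (e', e) \<in> R t")
      case True
      then have "locally_above t e x"
        using e dense assms dx by (intro locally_aboveI[OF assms(1) _ open_better[OF t, of d]]) auto
      then show ?thesis using e by (auto simp: above_def)
    next
      case False
      then obtain e' where e': "e' \<in> dense" "(d, e') \<notin> R t" "(e', e) \<notin> R t"
        by blast
      then have "(e', x) \<notin> R t"
        using R_transD assms(4) ye by blast
      then show ?thesis using above_between assms e' by blast
    qed
  qed
qed

text \<open>Each intermediate point makes an open order interval meet \<open>K\<close>, hence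
  \<open>dense\<close>: \<open>y\<close> yields \<open>e1\<close> between \<open>y'\<close> and
  \<open>x\<close>, and \<open>y'\<close> yields \<open>e2\<close> between \<open>z\<close> and
  \<open>e1\<close>. Then \<open>e1\<close> certifies \<open>above t e2 x\<close>, while
  \<open>e2\<close> being better than \<open>z\<close> excludes \<open>above t e2 z\<close>.\<close>

lemma above_separates:
  assumes "x \<in> K" "y \<in> K" "y' \<in> K" "z \<in> K"
    and "(y, x) \<notin> R t" "(y', y) \<notin> R t" "(z, y') \<notin> R t"
  shows "\<exists>d\<in>dense. above t d x \<and> \<not> above t d z"
proof -
  have "open ({w. (y', w) \<notin> R t} \<inter> {w. (w, x) \<notin> R t})"
    by (intro open_Int open_better open_worse t)
  then obtain e1 where e1: "e1 \<in> dense" "(y', e1) \<notin> R t" "(e1, x) \<notin> R t"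
    using dense_witness[of _ y] assms by blast
  have "open ({w. (z, w) \<notin> R t} \<inter> {w. (w, e1) \<notin> R t})"
    by (intro open_Int open_better open_worse t)
  then obtain e2 where e2: "e2 \<in> dense" "(z, e2) \<notin> R t" "(e2, e1) \<notin> R t"
    using dense_witness[of _ y'] assms e1 by blast
  have "above t e2 x"
    using above_between e1 e2 assms by blast
  moreover have "\<not> above t e2 z"
    using above_strict[of z e2] e2 dense assms strict_weak by blast
  ultimately show ?thesis using e2 by blast
qed

end

lemma above_sets:
  assumes f [measurable]: "f \<in> borel_measurable M" and d: "d \<in> dense"
  shows "{t \<in> space M. above t d (f t)} \<in> sets M"
proof -
  have [measurable]: "V \<in> sets borel" if "V \<in> base" for V
    using topological_basis_open[OF base(2) that] by simp
  have R: "{t \<in> space M. (x, y) \<in> R t} \<in> sets M" if "x \<in> dense" "y \<in> dense" for x y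
    using R_sets that dense by blast
  have [measurable]: "Measurable.pred M (\<lambda>t. (x, y) \<in> R t)" if "x \<in> dense" "y \<in> dense" for x y
    using R[OF that] by (simp add: pred_def)
  have ex: "Measurable.pred M (\<lambda>t. \<exists>i\<in>I. P i t)" and all: "Measurable.pred M (\<lambda>t. \<forall>i\<in>I. P i t)"
    if "countable I" "\<And>i. i \<in> I \<Longrightarrow> Measurable.pred M (P i)" for I :: "'i set" and P
    using that by (auto simp: pred_def intro!: sets.sets_Collect_countable_Ex' sets.sets_Collect_countable_All')
  have "Measurable.pred M (\<lambda>t. \<exists>e\<in>dense. (d, e) \<notin> R t \<and> (\<exists>V\<in>base. f t \<in> V \<and> (\<forall>e'\<in>dense. e' \<in> V \<longrightarrow> (e', e) \<in> R t)))"
    using d by (intro ex all pred_intros_logic(2-4) base(1) dense(1)) measurable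
  then have "{t \<in> space M. \<exists>e\<in>dense. (d, e) \<notin> R t \<and> (\<exists>V\<in>base. f t \<in> V \<and> (\<forall>e'\<in>dense \<inter> V. (e', e) \<in> R t))} \<in> sets M"
    by (simp add: pred_def Ball_def imp_conjL)
  then show ?thesis
    unfolding above_def locally_above_def .
qed

section \<open>Existence of a maximal selection\<close>

theorem maximal_selection:
  assumes ne: "\<A> \<noteq> {}"
    and meas: "\<And>f. f \<in> \<A> \<Longrightarrow> f \<in> borel_measurable M"
    and in_K: "\<And>f. f \<in> \<A> \<Longrightarrow> AE t in M. f t \<in> K"
    and lim: "\<And>s :: nat \<Rightarrow> 'a \<Rightarrow> 'b. (\<And>n. s n \<in> \<A>) \<Longrightarrow>
      \<exists>f\<in>\<A>. AE t in M. \<forall>m. f t \<in> closure ((\<lambda>n. s n t) ` {m..})"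
  shows "\<exists>f\<in>\<A>. \<forall>g\<in>\<A>. \<forall>A\<in>sets M. (AE t in M. (g t, f t) \<in> R t) \<longrightarrow>
    (\<forall>t\<in>A. (f t, g t) \<notin> R t) \<longrightarrow> measure M A = 0"
proof -
  define le where "le f g \<longleftrightarrow> (AE t in M. (g t, f t) \<in> R t)" for f g
  have le_trans: "le f h" if "le f g" "le g h" for f g h
    using that AE_space[of M] unfolding le_def
    by eventually_elim (meson R_transD)
  have le_refl: "le f f" if "f \<in> \<A>" for f
    using in_K[OF that] AE_space[of M] unfolding le_def
    by eventually_elim (use R_complete in blast)
  have le_chain: "\<exists>u\<in>\<A>. \<forall>n. le (s n) u" if s: "\<And>n. s n \<in> \<A>" "\<And>n. le (s n) (s (Suc n))" for s
  proof -
    obtain f where f: "f \<in> \<A>" "AE t in M. \<forall>m. f t \<in> closure ((\<lambda>n. s n t) ` {m..})"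
      using lim[of s] s by blast
    have "le (s n) f" for n
    proof -
      have "le (s m) (s n)" if "m \<le> n" for m n
        using that
      proof (induction rule: dec_induct)
        case base
        show ?case by (rule le_refl[OF s(1)])
      next
        case (step n)
        then show ?case using le_trans[OF _ s(2)] by blast
      qed
      then have "AE t in M. \<forall>n\<in>{m..}. (s n t, s m t) \<in> R t" for m
        by (auto simp: le_def AE_ball_countable)
      from this[of n] f(2) AE_space[of M] show ?thesis
        unfolding le_def
      proof eventually_elim
        case (elim t)
        \<comment> \<open>The tail of the chain from \<open>n\<close> on lies in the closed set of
          points weakly preferred to \<open>s n t\<close>, hence so do its cluster points.\<close>
        have "closed ((\<lambda>z. (z, s n t)) -` R t)"
          by (intro closed_vimage R_closed elim continuous_intros)
        then have "closure ((\<lambda>k. s k t) ` {n..}) \<subseteq> (\<lambda>z. (z, s n t)) -` R t"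
          using elim(1) by (intro closure_minimal) auto
        then show ?case using elim(2) by blast
      qed
    qed
    then show ?thesis using f by blast
  qed
  \<comment> \<open>By \<open>above_mono\<close> the sets where \<open>above t d (f t)\<close> holds
    can only grow along \<open>le\<close>, so stabilising their measures freezes them up to null
    sets.\<close>
  have stage1: "\<exists>f\<in>\<A>. \<forall>g\<in>\<A>. le f g \<longrightarrow> (AE t in M. \<forall>d\<in>dense. above t d (g t) \<longrightarrow> above t d (f t))"
  proof (cases "dense = {}")
    case True
    then show ?thesis using ne by auto
  next
    case False
    define \<phi> where "\<phi> n f = measure M {t \<in> space M. above t (from_nat_into dense n) (f t)}" for n f
    have d: "from_nat_into dense n \<in> dense" for n
      using False by (rule from_nat_into)
    have mono: "AE t in M. above t e (f t) \<longrightarrow> above t e (g t)"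
      if "f \<in> \<A>" "g \<in> \<A>" "le f g" "e \<in> dense" for f g e
      using that(3)[unfolded le_def] in_K[OF that(1)] in_K[OF that(2)] AE_space[of M]
    proof eventually_elim
      case (elim t)
      then show ?case using above_mono[of t "g t" "f t" e] that(4) dense by blast
    qed
    obtain f0 where f0: "f0 \<in> \<A>" using ne by blast
    have "\<exists>f\<in>\<A>. le f0 f \<and> (\<forall>g\<in>\<A>. le f g \<longrightarrow> (\<forall>n. \<phi> n g = \<phi> n f))"
    proof (rule ordering_principle_countable[where le = le and A = \<A>])
      show "\<phi> n x \<le> \<phi> n y" if "x \<in> \<A>" "y \<in> \<A>" "le x y" for n x y
        unfolding \<phi>_def using mono[OF that d[of n]] that meas above_sets d
        by (intro finite_measure_mono_AE) auto
      show "bdd_above (\<phi> n ` \<A>)" for n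
        unfolding \<phi>_def by (intro bdd_aboveI2[where M="measure M (space M)"] bounded_measure)
      show "le x z" if "le x y" "le y z" for x y z
        using le_trans that .
    qed (fact le_refl le_chain f0)+
    then obtain f where f: "f \<in> \<A>" "\<And>g n. g \<in> \<A> \<Longrightarrow> le f g \<Longrightarrow> \<phi> n g = \<phi> n f"
      by blast
    have "AE t in M. above t e (g t) \<longrightarrow> above t e (f t)" if g: "g \<in> \<A>" "le f g" and e: "e \<in> dense" for g e
    proof -
      obtain n where n: "e = from_nat_into dense n"
        using e dense(1) by (metis from_nat_into_surj)
      let ?F = "{t \<in> space M. above t e (f t)}" and ?G = "{t \<in> space M. above t e (g t)}"
      have sets: "?F \<in> sets M" "?G \<in> sets M"
        using above_sets meas f g e by auto
      have "measure M (?F \<inter> ?G) = measure M ?F"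
        using mono[OF f(1) g e] sets by (intro finite_measure_eq_AE) auto
      moreover have "measure M ?G = measure M ?F"
        using f(2)[OF g, of n] by (simp add: \<phi>_def n)
      moreover have "measure M (?G - ?F) = measure M ?G - measure M (?F \<inter> ?G)"
        using finite_measure_Diff'[OF sets(2,1)] by (simp add: Int_commute)
      ultimately have "measure M (?G - ?F) = 0" by simp
      then have "?G - ?F \<in> null_sets M"
        using sets by (auto simp: null_sets_def emeasure_eq_measure)
      then show ?thesis
        by (rule AE_I') auto
    qed
    then show ?thesis
      using f(1) dense(1) by (auto simp: AE_ball_countable)
  qed
  \<comment> \<open>Wherever some \<open>g\<close> strictly improves on \<open>f'\<close>, already
    \<open>f'\<close> strictly improves on \<open>f\<close>: otherwise \<open>g\<close> would beat
    \<open>f\<close> on a larger set than \<open>f'\<close> does.\<close>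
  have stage2: "\<exists>f'\<in>\<A>. le f f' \<and> (\<forall>g\<in>\<A>. le f' g \<longrightarrow> (\<forall>A\<in>sets M.
      (AE t in M. t \<in> A \<longrightarrow> (f' t, g t) \<notin> R t) \<longrightarrow> (AE t in M. t \<in> A \<longrightarrow> (f t, f' t) \<notin> R t)))"
    if f: "f \<in> \<A>" for f
  proof -
    \<comment> \<open>\<open>\<S> g\<close> consists of the measurable sets on which, up to null
      sets, \<open>g\<close> is strictly preferred to \<open>f\<close>; \<open>\<phi> g\<close> acts
      as the inner measure of the set of strict improvement.\<close>
    define \<S> where "\<S> g = {A \<in> sets M. AE t in M. t \<in> A \<longrightarrow> (f t, g t) \<notin> R t}" for g
    define \<phi> where "\<phi> g = (SUP A\<in>\<S> g. measure M A)" for g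
    have S_ne: "{} \<in> \<S> g" for g by (auto simp: \<S>_def)
    have bdd: "bdd_above (measure M ` \<S> g)" for g
      by (intro bdd_aboveI2[where M="measure M (space M)"] bounded_measure)
    have S_mono: "\<S> g \<subseteq> \<S> h" if "le g h" for g h
    proof
      fix A assume "A \<in> \<S> g"
      then have A: "A \<in> sets M" "AE t in M. t \<in> A \<longrightarrow> (f t, g t) \<notin> R t"
        by (auto simp: \<S>_def)
      from A(2) that[unfolded le_def] AE_space[of M] have "AE t in M. t \<in> A \<longrightarrow> (f t, h t) \<notin> R t"
        by eventually_elim (meson R_transD)
      then show "A \<in> \<S> h" using A by (auto simp: \<S>_def)
    qed
    have "\<exists>f'\<in>\<A>. le f f' \<and> (\<forall>g\<in>\<A>. le f' g \<longrightarrow> \<phi> g = \<phi> f')"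
    proof (rule ordering_principle[where le = le and A = \<A>])
      show "\<phi> x \<le> \<phi> y" if "le x y" for x y
        unfolding \<phi>_def using S_ne S_mono[OF that] bdd by (intro cSUP_subset_mono) auto
      show "bdd_above (\<phi> ` \<A>)"
        unfolding \<phi>_def
        by (intro bdd_aboveI2[where M="measure M (space M)"] cSUP_least bounded_measure)
          (use S_ne in auto)
      show "le x z" if "le x y" "le y z" for x y z
        using le_trans that .
    qed (fact le_refl le_chain f)+
    then obtain f' where f': "f' \<in> \<A>" "le f f'" "\<And>g. g \<in> \<A> \<Longrightarrow> le f' g \<Longrightarrow> \<phi> g = \<phi> f'"
      by blast
    show ?thesis
    proof (intro bexI[OF _ f'(1)] conjI f'(2) ballI impI)
      fix g A assume g: "g \<in> \<A>" "le f' g" and A: "A \<in> sets M" "AE t in M. t \<in> A \<longrightarrow> (f' t, g t) \<notin> R t"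
      have "\<exists>A1\<in>\<S> f'. \<phi> f' - 1 / Suc n < measure M A1" for n
        unfolding \<phi>_def by (subst less_cSUP_iff[symmetric]) (use S_ne[of f'] bdd in auto)
      then obtain A1 where A1: "\<And>n. A1 n \<in> \<S> f'" "\<And>n. \<phi> f' - 1 / Suc n < measure M (A1 n)"
        by metis
      have gA: "AE t in M. t \<in> A \<longrightarrow> (f t, g t) \<notin> R t"
        using A(2) f'(2)[unfolded le_def] AE_space[of M] in_K[OF g(1)] in_K[OF f'(1)]
        by eventually_elim (meson R_transD strict_weak)
      \<comment> \<open>\<open>C\<close> attains the supremum \<open>\<phi> f'\<close>, so a
        non-null part of \<open>A\<close> outside \<open>C\<close> would push
        \<open>\<phi> g\<close> above \<open>\<phi> f'\<close>.\<close>
      define C where "C = (\<Union>n. A1 n)"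
      have "AE t in M. \<forall>n. t \<in> A1 n \<longrightarrow> (f t, f' t) \<notin> R t"
        using A1(1) unfolding AE_all_countable by (simp add: \<S>_def)
      then have "AE t in M. t \<in> C \<longrightarrow> (f t, f' t) \<notin> R t"
        by eventually_elim (auto simp: C_def)
      moreover have "A1 n \<in> sets M" for n
        using A1(1)[of n] by (simp add: \<S>_def)
      then have "C \<in> sets M"
        unfolding C_def by (intro sets.countable_UN) auto
      ultimately have C: "C \<in> \<S> f'"
        by (simp add: \<S>_def)
      then have "C \<in> \<S> g" using S_mono g by blast
      then have "A \<union> C \<in> \<S> g"
        using A gA unfolding \<S>_def by auto
      then have "measure M (A \<union> C) \<le> \<phi> g"
        unfolding \<phi>_def using bdd by (intro cSUP_upper) auto
      then have le: "measure M (A \<union> C) \<le> \<phi> f'" using f'(3)[OF g] by simp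
      have Cs [measurable]: "C \<in> sets M" using C by (auto simp: \<S>_def)
      have "\<phi> f' \<le> measure M C + 1 / Suc n" for n
      proof -
        have "measure M (A1 n) \<le> measure M C"
          by (rule finite_measure_mono[OF _ Cs]) (auto simp: C_def)
        then show ?thesis using A1(2)[of n] by linarith
      qed
      then have "\<phi> f' \<le> measure M C"
        by (rule le_if_le_add_inverse_Suc)
      moreover have "measure M (A \<union> C) = measure M C + measure M (A - C)"
        using finite_measure_Union'[OF Cs A(1)] by (simp add: Un_commute)
      ultimately have "measure M (A - C) = 0"
        using le by (intro antisym) auto
      then have "A - C \<in> null_sets M"
        using A Cs by (auto simp: null_sets_def emeasure_eq_measure)
      from AE_not_in[OF this] have "AE t in M. t \<in> A \<longrightarrow> t \<in> C"
        by eventually_elim auto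
      then show "AE t in M. t \<in> A \<longrightarrow> (f t, f' t) \<notin> R t"
        using \<open>AE t in M. t \<in> C \<longrightarrow> _\<close> by eventually_elim auto
    qed
  qed
  \<comment> \<open>Beyond \<open>f0\<close> the values of \<open>above\<close> are frozen, so at most three indifference classes can be met
    in succession; an improvement on \<open>f2\<close> would be the fourth.\<close>
  obtain f0 where f0: "f0 \<in> \<A>" "\<And>g. g \<in> \<A> \<Longrightarrow> le f0 g \<Longrightarrow>
      AE t in M. \<forall>d\<in>dense. above t d (g t) \<longrightarrow> above t d (f0 t)"
    using stage1 by blast
  obtain f1 where f1: "f1 \<in> \<A>" "le f0 f1" "\<And>g A. g \<in> \<A> \<Longrightarrow> le f1 g \<Longrightarrow> A \<in> sets M \<Longrightarrow>
      AE t in M. t \<in> A \<longrightarrow> (f1 t, g t) \<notin> R t \<Longrightarrow> AE t in M. t \<in> A \<longrightarrow> (f0 t, f1 t) \<notin> R t"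
    using stage2[OF f0(1)] by blast
  obtain f2 where f2: "f2 \<in> \<A>" "le f1 f2" "\<And>g A. g \<in> \<A> \<Longrightarrow> le f2 g \<Longrightarrow> A \<in> sets M \<Longrightarrow>
      AE t in M. t \<in> A \<longrightarrow> (f2 t, g t) \<notin> R t \<Longrightarrow> AE t in M. t \<in> A \<longrightarrow> (f1 t, f2 t) \<notin> R t"
    using stage2[OF f1(1)] by blast
  show ?thesis
  proof (intro bexI[OF _ f2(1)] ballI impI)
    fix g A assume g: "g \<in> \<A>" and A: "A \<in> sets M" and "AE t in M. (g t, f2 t) \<in> R t"
      and strict: "\<forall>t\<in>A. (f2 t, g t) \<notin> R t"
    then have le: "le f2 g" by (simp add: le_def)
    have 2: "AE t in M. t \<in> A \<longrightarrow> (f1 t, f2 t) \<notin> R t"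
      using f2(3)[OF g le A] strict by auto
    then have 1: "AE t in M. t \<in> A \<longrightarrow> (f0 t, f1 t) \<notin> R t"
      using f1(3)[OF f2(1,2) A] by blast
    have "AE t in M. \<forall>d\<in>dense. above t d (g t) \<longrightarrow> above t d (f0 t)"
      by (rule f0(2)[OF g le_trans[OF f1(2) le_trans[OF f2(2) le]]])
    then have "AE t in M. t \<notin> A"
      using 1 2 AE_space[of M] in_K[OF g] in_K[OF f0(1)] in_K[OF f1(1)] in_K[OF f2(1)]
    proof eventually_elim
      case (elim t)
      then show ?case
        using above_separates[of t "g t" "f2 t" "f1 t" "f0 t"] strict by blast
    qed
    then show "measure M A = 0"
      using AE_iff_null_sets[OF A] by (simp add: measure_eq_0_null_sets)
  qed
qed

end

subsection \<open>Relatively atomless measures\<close>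

text \<open>The dense set consists of rational combinations of indicators of finite intersections
  from \<A>. These intersections form a \<pi>-system, so induction over complements and disjoint
  unions reaches the indicator of every generated set; \<open>gen\<close> extends this to all
  measurable sets, and approximation by simple functions does the rest.\<close>

lemma (in finite_measure) L1_separable_if_countably_generated:
  assumes \<A>: "countable \<A>" "\<A> \<subseteq> sets M"
    and gen: "\<And>F. F \<in> sets M \<Longrightarrow> \<exists>G\<in>sigma_sets (space M) \<A>. AE t in M. t \<in> F \<longleftrightarrow> t \<in> G"
  shows "L1_separable M"
proof -
  define \<C> where "\<C> = insert (space M) ((\<lambda>S. \<Inter>S) ` {S. finite S \<and> S \<noteq> {} \<and> S \<subseteq> \<A>})"
  have "countable {S. finite S \<and> S \<noteq> {} \<and> S \<subseteq> \<A>}"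
    by (rule countable_subset[OF _ countable_Collect_finite_subset[OF \<A>(1)]]) auto
  then have \<C>_countable: "countable \<C>"
    by (simp add: \<C>_def)
  have \<C>_sets: "\<C> \<subseteq> sets M"
  proof
    fix A assume "A \<in> \<C>"
    then consider "A = space M" | S where "A = \<Inter>S" "finite S" "S \<noteq> {}" "S \<subseteq> \<A>"
      by (auto simp: \<C>_def)
    then show "A \<in> sets M"
    proof cases
      case 2
      then show ?thesis using sets.finite_INT[of S "\<lambda>x. x" M] \<A>(2) by auto
    qed auto
  qed
  have \<A>_\<C>: "\<A> \<subseteq> \<C>"
  proof
    fix A assume "A \<in> \<A>"
    then have "\<Inter>{A} \<in> \<C>" unfolding \<C>_def by blast
    then show "A \<in> \<C>" by simp
  qed
  have \<C>_Int: "Int_stable \<C>"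
  proof (rule Int_stableI)
    fix a b assume ab: "a \<in> \<C>" "b \<in> \<C>"
    then have sub: "a \<subseteq> space M" "b \<subseteq> space M"
      using \<C>_sets sets.sets_into_space by auto
    show "a \<inter> b \<in> \<C>"
    proof (cases "a = space M \<or> b = space M")
      case True
      then show ?thesis using ab sub by (auto simp: Int_absorb1 Int_absorb2)
    next
      case False
      then obtain S T where "a = \<Inter>S" "b = \<Inter>T" "finite S" "finite T" "S \<noteq> {}" "T \<noteq> {}" "S \<subseteq> \<A>" "T \<subseteq> \<A>"
        using ab by (auto simp: \<C>_def)
      then have "a \<inter> b = \<Inter>(S \<union> T)" "finite (S \<union> T)" "S \<union> T \<noteq> {}" "S \<union> T \<subseteq> \<A>"
        by auto
      then show ?thesis unfolding \<C>_def by blast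
    qed
  qed
  \<comment> \<open>Lists with repetitions make a sum a concatenation and a rational multiple a
    \<open>map\<close>; countability of \<open>\<D>\<close> is that of lists over a countable
    set.\<close>
  define val :: "(rat \<times> 'a set) list \<Rightarrow> 'a \<Rightarrow> real" where
    "val ps = (\<lambda>t. \<Sum>(q, A)\<leftarrow>ps. of_rat q * indicator A t)" for ps
  define \<D> where "\<D> = val ` lists (UNIV \<times> \<C>)"
  have val_int: "integrable M (val ps)" if "ps \<in> lists (UNIV \<times> \<C>)" for ps
    using that
  proof (induction ps)
    case Nil
    then show ?case by (simp add: val_def)
  next
    case (Cons p ps)
    then have "integrable M (\<lambda>t. of_rat (fst p) * indicator (snd p) t + val ps t)"
      using \<C>_sets by (intro Bochner_Integration.integrable_add integrable_mult_right)
        (auto simp: emeasure_eq_measure)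
    then show ?case by (simp add: val_def case_prod_unfold)
  qed
  define cl where "cl f \<longleftrightarrow> (\<forall>e>0. \<exists>d\<in>\<D>. (\<integral>t. \<bar>f t - d t\<bar> \<partial>M) < e)" for f
  have \<D>_int: "integrable M d" if "d \<in> \<D>" for d
    using that val_int by (auto simp: \<D>_def)
  have approx: "cl f" if f: "integrable M f" "\<And>e. e > 0 \<Longrightarrow> \<exists>g. integrable M g \<and> cl g \<and> (\<integral>t. \<bar>f t - g t\<bar> \<partial>M) < e" for f
    unfolding cl_def
  proof (intro allI impI)
    fix e :: real assume e: "e > 0"
    obtain g where g: "integrable M g" "cl g" "(\<integral>t. \<bar>f t - g t\<bar> \<partial>M) < e / 2"
      using f(2)[of "e / 2"] e by auto
    obtain d where d: "d \<in> \<D>" "(\<integral>t. \<bar>g t - d t\<bar> \<partial>M) < e / 2"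
      using g(2) e unfolding cl_def by (meson half_gt_zero)
    have "(\<integral>t. \<bar>f t - d t\<bar> \<partial>M) \<le> (\<integral>t. \<bar>f t - g t\<bar> + \<bar>g t - d t\<bar> \<partial>M)"
      using f(1) g(1) \<D>_int[OF d(1)] by (intro integral_mono) auto
    also have "\<dots> = (\<integral>t. \<bar>f t - g t\<bar> \<partial>M) + (\<integral>t. \<bar>g t - d t\<bar> \<partial>M)"
      using f(1) g(1) \<D>_int[OF d(1)] by (intro Bochner_Integration.integral_add) auto
    finally show "\<exists>d\<in>\<D>. (\<integral>t. \<bar>f t - d t\<bar> \<partial>M) < e"
      using d g by (intro bexI[OF _ d(1)]) linarith
  qed
  have cl_add: "cl (\<lambda>t. f t + g t)" if fg: "integrable M f" "integrable M g" "cl f" "cl g" for f g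
    unfolding cl_def
  proof (intro allI impI)
    fix e :: real assume e: "e > 0"
    obtain c where c: "c \<in> \<D>" "(\<integral>t. \<bar>f t - c t\<bar> \<partial>M) < e / 2"
      using fg(3) e unfolding cl_def by (meson half_gt_zero)
    obtain d where d: "d \<in> \<D>" "(\<integral>t. \<bar>g t - d t\<bar> \<partial>M) < e / 2"
      using fg(4) e unfolding cl_def by (meson half_gt_zero)
    obtain ps qs where "c = val ps" "d = val qs" "ps \<in> lists (UNIV \<times> \<C>)" "qs \<in> lists (UNIV \<times> \<C>)"
      using c d by (auto simp: \<D>_def)
    then have "(\<lambda>t. c t + d t) = val (ps @ qs)" "ps @ qs \<in> lists (UNIV \<times> \<C>)"
      by (auto simp: val_def)
    then have cd: "(\<lambda>t. c t + d t) \<in> \<D>"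
      unfolding \<D>_def by auto
    have "(\<integral>t. \<bar>(f t + g t) - (c t + d t)\<bar> \<partial>M) \<le> (\<integral>t. \<bar>f t - c t\<bar> + \<bar>g t - d t\<bar> \<partial>M)"
      using fg(1,2) \<D>_int[OF c(1)] \<D>_int[OF d(1)] by (intro integral_mono) auto
    also have "\<dots> = (\<integral>t. \<bar>f t - c t\<bar> \<partial>M) + (\<integral>t. \<bar>g t - d t\<bar> \<partial>M)"
      using fg(1,2) \<D>_int[OF c(1)] \<D>_int[OF d(1)] by (intro Bochner_Integration.integral_add) auto
    finally show "\<exists>d\<in>\<D>. (\<integral>t. \<bar>(f t + g t) - d t\<bar> \<partial>M) < e"
      using c d by (intro bexI[OF _ cd]) linarith
  qed
  have cl_scale: "cl (\<lambda>t. r * f t)" if f: "integrable M f" "cl f" for f r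
    unfolding cl_def
  proof (intro allI impI)
    fix e :: real assume e: "e > 0"
    \<comment> \<open>The error is split as \<open>(r - q) f + q (f - d)\<close> with
      \<open>e / 2\<close> for each part; the added 1, here and next to \<open>q\<close>, keeps the
      divisors positive.\<close>
    define I where "I = (\<integral>t. \<bar>f t\<bar> \<partial>M) + 1"
    have I: "I > 0" by (simp add: I_def add_nonneg_pos)
    obtain q where q: "r < of_rat q" "of_rat q < r + e / (2 * I)"
      using of_rat_dense[of r "r + e / (2 * I)"] e I by auto
    have q': "\<bar>r - of_rat q\<bar> * I \<le> e / 2"
      using q I by (simp add: field_simps)
    obtain d where d: "d \<in> \<D>" "(\<integral>t. \<bar>f t - d t\<bar> \<partial>M) < e / (2 * (\<bar>of_rat q\<bar> + 1))"
      using f(2) e unfolding cl_def by (metis abs_ge_zero add_nonneg_pos divide_pos_pos mult_pos_pos zero_less_numeral zero_less_one)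
    obtain ps where ps: "d = val ps" "ps \<in> lists (UNIV \<times> \<C>)"
      using d by (auto simp: \<D>_def)
    have "(\<lambda>t. of_rat q * d t) = val (map (\<lambda>(p, A). (q * p, A)) ps)"
      unfolding ps(1) by (auto simp: val_def o_def case_prod_unfold of_rat_mult sum_list_const_mult mult.assoc)
    moreover have "map (\<lambda>(p, A). (q * p, A)) ps \<in> lists (UNIV \<times> \<C>)"
      using ps(2) by auto
    ultimately have qd: "(\<lambda>t. of_rat q * d t) \<in> \<D>"
      unfolding \<D>_def by blast
    have "(\<integral>t. \<bar>r * f t - of_rat q * d t\<bar> \<partial>M)
        \<le> (\<integral>t. \<bar>r - of_rat q\<bar> * \<bar>f t\<bar> + \<bar>of_rat q\<bar> * \<bar>f t - d t\<bar> \<partial>M)"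
    proof (intro integral_mono)
      fix t
      have "r * f t - of_rat q * d t = (r - of_rat q) * f t + of_rat q * (f t - d t)"
        by (simp add: algebra_simps)
      then show "\<bar>r * f t - of_rat q * d t\<bar> \<le> \<bar>r - of_rat q\<bar> * \<bar>f t\<bar> + \<bar>of_rat q\<bar> * \<bar>f t - d t\<bar>"
        by (metis abs_mult abs_triangle_ineq)
    qed (use f(1) \<D>_int[OF d(1)] in auto)
    also have "\<dots> = \<bar>r - of_rat q\<bar> * (\<integral>t. \<bar>f t\<bar> \<partial>M) + \<bar>of_rat q\<bar> * (\<integral>t. \<bar>f t - d t\<bar> \<partial>M)"
      using f(1) \<D>_int[OF d(1)] by simp
    also have "\<bar>r - of_rat q\<bar> * (\<integral>t. \<bar>f t\<bar> \<partial>M) \<le> e / 2"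
      by (rule order_trans[OF mult_left_mono q']) (auto simp: I_def)
    also have "\<bar>of_rat q\<bar> * (\<integral>t. \<bar>f t - d t\<bar> \<partial>M) < e / 2"
    proof -
      define c where "c = \<bar>of_rat q :: real\<bar> + 1"
      have "c > 0" by (simp add: c_def add_nonneg_pos)
      then have "c * (\<integral>t. \<bar>f t - d t\<bar> \<partial>M) < e / 2"
        using d(2) unfolding c_def[symmetric] by (simp add: field_simps)
      then have "(\<bar>of_rat q\<bar> + 1) * (\<integral>t. \<bar>f t - d t\<bar> \<partial>M) < e / 2"
        by (simp add: c_def)
      moreover have "\<bar>of_rat q\<bar> * (\<integral>t. \<bar>f t - d t\<bar> \<partial>M) \<le> (\<bar>of_rat q\<bar> + 1) * (\<integral>t. \<bar>f t - d t\<bar> \<partial>M)"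
        by (intro mult_right_mono) auto
      ultimately show ?thesis by (rule order.strict_trans1[rotated])
    qed
    finally show "\<exists>d\<in>\<D>. (\<integral>t. \<bar>r * f t - d t\<bar> \<partial>M) < e"
      by (intro bexI[OF _ qd]) simp
  qed
  have cl_gen: "cl (indicator G)" if "G \<in> sigma_sets (space M) \<A>" for G
  proof -
    have G: "G \<in> sigma_sets (space M) \<C>"
      using sigma_sets_mono'[OF \<A>_\<C>] that by blast
    have sub: "sigma_sets (space M) \<C> \<subseteq> sets M"
      by (rule sets.sigma_sets_subset[OF \<C>_sets])
    show ?thesis
    proof (rule sigma_sets_induct_disjoint[OF \<C>_Int _ G, of "\<lambda>G. cl (indicator G)"])
      show "\<C> \<subseteq> Pow (space M)" using \<C>_sets sets.space_closed by blast
    next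
      fix A assume A: "A \<in> \<C>"
      then have "val [(1, A)] \<in> \<D>" unfolding \<D>_def by auto
      moreover have "val [(1, A)] = indicator A" by (auto simp: val_def)
      ultimately show "cl (indicator A)" unfolding cl_def
        by (auto intro!: bexI[of _ "indicator A"])
    next
      have "val [] \<in> \<D>" unfolding \<D>_def by auto
      then show "cl (indicator {})" unfolding cl_def
        by (auto intro!: bexI[of _ "val []"] simp: val_def)
    next
      fix A assume A: "A \<in> sigma_sets (space M) \<C>" "cl (indicator A)"
      have 1: "cl (indicator (space M))"
      proof -
        have "val [(1, space M)] \<in> \<D>" unfolding \<D>_def \<C>_def by auto
        then show ?thesis unfolding cl_def
          by (auto intro!: bexI[of _ "val [(1, space M)]"] simp: val_def)
      qed
      have [measurable]: "A \<in> sets M" using A sub by blast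
      have "cl (\<lambda>t. indicator (space M) t + (-1) * indicator A t)"
        by (intro cl_add cl_scale A 1) (auto simp: emeasure_eq_measure)
      moreover have "(\<lambda>t. indicator (space M) t + (-1) * indicator A t) = (indicator (space M - A) :: 'a \<Rightarrow> real)"
        using sets.sets_into_space[OF \<open>A \<in> sets M\<close>] by (auto simp: fun_eq_iff split: split_indicator)
      ultimately show "cl (indicator (space M - A))" by simp
    next
      fix A :: "nat \<Rightarrow> 'a set"
      assume A: "disjoint_family A" "range A \<subseteq> sigma_sets (space M) \<C>" "\<And>i. cl (indicator (A i))"
      have As [measurable]: "A i \<in> sets M" for i using A(2) sub by blast
      have fin: "cl (indicator (\<Union>i<n. A i))" for n
      proof (induction n)
        case 0
        have "val [] \<in> \<D>" unfolding \<D>_def by auto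
        then show ?case unfolding cl_def
          by (auto intro!: bexI[of _ "val []"] simp: val_def)
      next
        case (Suc n)
        have "cl (\<lambda>t. indicator (\<Union>i<n. A i) t + indicator (A n) t)"
          by (intro cl_add A Suc) (auto simp: emeasure_eq_measure)
        moreover have "(\<Union>i<n. A i) \<inter> A n = {}"
          using A(1) unfolding disjoint_family_on_def by (auto dest: less_imp_neq)
        then have "(\<lambda>t. indicator (\<Union>i<n. A i) t + indicator (A n) t) = (indicator (\<Union>i<Suc n. A i) :: 'a \<Rightarrow> real)"
          by (auto simp: fun_eq_iff lessThan_Suc split: split_indicator)
        ultimately show ?case by simp
      qed
      show "cl (indicator (\<Union>i. A i))"
      proof (rule approx)
        show "integrable M (indicator (\<Union>i. A i) :: 'a \<Rightarrow> real)"
          by (auto simp: emeasure_eq_measure)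
        fix e :: real assume e: "e > 0"
        have "(\<lambda>n. measure M (\<Union>i<n. A i)) \<longlonglongrightarrow> measure M (\<Union>n. \<Union>i<n. A i)"
          by (rule finite_Lim_measure_incseq) (auto simp: incseq_def intro: less_le_trans)
        also have "(\<Union>n. \<Union>i<n. A i) = (\<Union>i. A i)" by auto
        finally have "\<exists>n. dist (measure M (\<Union>i<n. A i)) (measure M (\<Union>i. A i)) < e"
          using e unfolding tendsto_iff eventually_sequentially by blast
        then obtain n where n: "\<bar>measure M (\<Union>i<n. A i) - measure M (\<Union>i. A i)\<bar> < e"
          by (auto simp: dist_real_def)
        have "(\<integral>t. \<bar>indicator (\<Union>i. A i) t - indicator (\<Union>i<n. A i) t :: real\<bar> \<partial>M)
            = (\<integral>t. indicator ((\<Union>i. A i) - (\<Union>i<n. A i)) t \<partial>M)"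
          by (intro Bochner_Integration.integral_cong refl) (auto split: split_indicator)
        also have "\<dots> = measure M ((\<Union>i. A i) - (\<Union>i<n. A i))"
          by (subst Bochner_Integration.integral_indicator) (auto simp: emeasure_eq_measure Int_absorb2 sets.sets_into_space)
        also have "\<dots> = measure M (\<Union>i. A i) - measure M (\<Union>i<n. A i)"
          by (rule finite_measure_Diff) auto
        also have "\<dots> < e" using n by linarith
        finally show "\<exists>g. integrable M g \<and> cl g \<and> (\<integral>t. \<bar>indicator (\<Union>i. A i) t - g t\<bar> \<partial>M) < e"
          using fin[of n] by (intro exI[of _ "indicator (\<Union>i<n. A i)"]) (auto simp: emeasure_eq_measure)
      qed
    qed
  qed
  have cl_cong: "cl f" if "cl g" "AE t in M. f t = g t" "f \<in> borel_measurable M" "g \<in> borel_measurable M" for f g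
  proof -
    have "(\<integral>t. \<bar>f t - d t\<bar> \<partial>M) = (\<integral>t. \<bar>g t - d t\<bar> \<partial>M)" if "d \<in> \<D>" for d
      using \<D>_int[OF that] \<open>AE t in M. f t = g t\<close> \<open>f \<in> _\<close> \<open>g \<in> _\<close>
      by (intro integral_cong_AE) auto
    then show ?thesis using that(1) unfolding cl_def by auto
  qed
  have "cl f" if "integrable M f" for f
    using that
  proof (induct rule: integrable_induct)
    case (base A c)
    obtain G where G: "G \<in> sigma_sets (space M) \<A>" "AE t in M. t \<in> A \<longleftrightarrow> t \<in> G"
      using gen[OF base(1)] by blast
    have Gs [measurable]: "G \<in> sets M"
      using sets.sigma_sets_subset[OF \<A>(2)] G(1) by blast
    have "cl (\<lambda>t. c * indicator G t)"
      using cl_scale[OF _ cl_gen[OF G(1)]] by (auto simp: emeasure_eq_measure)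
    then show ?case
      by (rule cl_cong) (use G(2) base(1) in \<open>auto elim: eventually_mono simp: indicator_def\<close>)
  next
    case (add f g)
    then show ?case by (intro cl_add)
  next
    case (lim f s)
    show ?case
    proof (rule approx[OF lim(5)])
      fix e :: real assume e: "e > 0"
      have "(\<lambda>i. \<integral>t. \<bar>f t - s i t\<bar> \<partial>M) \<longlonglongrightarrow> (\<integral>t. 0 \<partial>M)"
      \<comment> \<open>The approximants obey
        \<open>\<bar>s i t\<bar> \<le> 2 * \<bar>f t\<bar>\<close>, whence the factor 3.\<close>
      proof (rule integral_dominated_convergence[where w="\<lambda>t. 3 * \<bar>f t\<bar>"])
        show "AE t in M. (\<lambda>i. \<bar>f t - s i t\<bar>) \<longlonglongrightarrow> 0"
        proof (rule AE_I2)
          fix t assume "t \<in> space M"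
          then have "(\<lambda>i. \<bar>f t - s i t\<bar>) \<longlonglongrightarrow> \<bar>f t - f t\<bar>"
            by (intro tendsto_intros lim(3))
          then show "(\<lambda>i. \<bar>f t - s i t\<bar>) \<longlonglongrightarrow> 0" by simp
        qed
        show "AE t in M. norm \<bar>f t - s i t\<bar> \<le> 3 * \<bar>f t\<bar>" for i
        proof (rule AE_I2)
          fix t assume "t \<in> space M"
          then show "norm \<bar>f t - s i t\<bar> \<le> 3 * \<bar>f t\<bar>"
            using lim(4)[of t i] abs_triangle_ineq4[of "f t" "s i t"] by simp
        qed
      qed (use lim(1,5) in auto)
      then have "\<exists>i. (\<integral>t. \<bar>f t - s i t\<bar> \<partial>M) < e"
        using e order_tendstoD(2)[of _ 0 sequentially e] by (force simp: eventually_sequentially)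
      then show "\<exists>g. integrable M g \<and> cl g \<and> (\<integral>t. \<bar>f t - g t\<bar> \<partial>M) < e"
        using lim(1,2) by blast
    qed
  qed
  moreover have "countable \<D>"
    unfolding \<D>_def using \<C>_countable by auto
  ultimately show ?thesis
    unfolding L1_separable_def using \<D>_int unfolding cl_def by blast
qed

text \<open>If every measurable subset of \<open>A\<close> agreed up to a null set with the trace on
  \<open>A\<close> of a generated set, the countably many traces of \<A> would generate the
  measurable subsets of \<open>A\<close> modulo null sets, and L1 over \<open>A\<close> would be
  separable. The set in the conclusion is the symmetric difference of \<open>F\<close> and
  \<open>A \<inter> G\<close>.\<close>

lemma saturated_relatively_atomless:
  assumes sat: "saturated_measure M" and \<A>: "countable \<A>" "\<A> \<subseteq> sets M"
    and A: "A \<in> sets M" "measure M A > 0"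
  shows "\<exists>F\<in>sets M. F \<subseteq> A \<and> (\<forall>G\<in>sigma_sets (space M) \<A>. measure M ((F - G) \<union> (A \<inter> G - F)) > 0)"
proof (rule ccontr)
  assume neg: "\<not> ?thesis"
  interpret finite_measure M
    using sat by (simp add: saturated_measure_def)
  let ?N = "restrict_space M A"
  interpret N: finite_measure ?N
    by (rule finite_measure_restrict_space) (use A finite_measure_axioms in auto)
  have sub: "A \<subseteq> space M"
    using A sets.sets_into_space by auto
  have space: "space ?N = A"
    using sub by (auto simp: space_restrict_space)
  have traces: "sigma_sets A ((\<inter>) A ` \<A>) \<supseteq> (\<inter>) A ` sigma_sets (space M) \<A>"
  proof clarify
    fix G assume "G \<in> sigma_sets (space M) \<A>"
    then show "A \<inter> G \<in> sigma_sets A ((\<inter>) A ` \<A>)"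
    proof induction
      case (Basic a)
      then show ?case by auto
    next
      case Empty
      then show ?case by (simp add: sigma_sets.Empty)
    next
      case (Compl a)
      have "A \<inter> (space M - a) = A - (A \<inter> a)" using sub by auto
      then show ?case using Compl by (simp add: sigma_sets.Compl)
    next
      case (Union a)
      then have "(\<Union>i. A \<inter> a i) \<in> sigma_sets A ((\<inter>) A ` \<A>)"
        by (intro sigma_sets.Union) auto
      then show ?case by simp
    qed
  qed
  have "L1_separable ?N"
  proof (rule N.L1_separable_if_countably_generated)
    show "countable ((\<inter>) A ` \<A>)" using \<A> by simp
    show "(\<inter>) A ` \<A> \<subseteq> sets ?N" using \<A> by (auto simp: sets_restrict_space)
    fix F assume "F \<in> sets ?N"
    then have F: "F \<in> sets M" "F \<subseteq> A"
      using A by (auto simp: sets_restrict_space)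
    then obtain G where G: "G \<in> sigma_sets (space M) \<A>" "\<not> measure M ((F - G) \<union> (A \<inter> G - F)) > 0"
      using neg by blast
    have Gs: "G \<in> sets M"
      using sets.sigma_sets_subset[OF \<A>(2)] G(1) by blast
    have "measure M ((F - G) \<union> (A \<inter> G - F)) = 0"
      using G(2) by (simp add: not_less measure_le_0_iff)
    then have "(F - G) \<union> (A \<inter> G - F) \<in> null_sets M"
      using A F Gs by (auto simp: null_sets_def emeasure_eq_measure)
    then have "AE t in M. t \<in> A \<longrightarrow> (t \<in> F \<longleftrightarrow> t \<in> A \<inter> G)"
      by (rule AE_I') (use F in auto)
    then have "AE t in ?N. t \<in> F \<longleftrightarrow> t \<in> A \<inter> G"
      using A by (simp add: AE_restrict_space_iff)
    then show "\<exists>G\<in>sigma_sets (space ?N) ((\<inter>) A ` \<A>). AE t in ?N. t \<in> F \<longleftrightarrow> t \<in> G"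
      using traces G(1) unfolding space by blast
  qed
  then show False
    using sat A by (auto simp: saturated_measure_def)
qed

section \<open>Sets with prescribed conditional measure over a sub-sigma-algebra\<close>

text \<open>On no \<open>A\<close> of positive measure do the traces of \<G> exhaust the measurable
  subsets modulo null sets. For trivial \<G> this is ordinary atomlessness.\<close>

locale relatively_atomless = finite_measure M
  for M :: "'a measure" +
  fixes \<G> :: "'a set set"
  assumes sigma_\<G>: "sigma_algebra (space M) \<G>"
    and \<G>_sets: "\<G> \<subseteq> sets M"
    and not_trace: "A \<in> sets M \<Longrightarrow> measure M A > 0 \<Longrightarrow>
      \<exists>F\<in>sets M. F \<subseteq> A \<and> (\<forall>G\<in>\<G>. measure M ((F - G) \<union> (A \<inter> G - F)) > 0)"
begin

lemma \<G>_Int: "X \<in> \<G> \<Longrightarrow> Y \<in> \<G> \<Longrightarrow> X \<inter> Y \<in> \<G>"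
  and \<G>_Diff: "X \<in> \<G> \<Longrightarrow> Y \<in> \<G> \<Longrightarrow> X - Y \<in> \<G>"
  and \<G>_empty: "{} \<in> \<G>"
  and \<G>_space: "space M \<in> \<G>"
proof -
  interpret sigma_algebra "space M" \<G>
    by (rule sigma_\<G>)
  show "X \<in> \<G> \<Longrightarrow> Y \<in> \<G> \<Longrightarrow> X \<inter> Y \<in> \<G>" "X \<in> \<G> \<Longrightarrow> Y \<in> \<G> \<Longrightarrow> X - Y \<in> \<G>"
    "{} \<in> \<G>" "space M \<in> \<G>"
    by auto
qed

lemma \<G>_in [simp]: "X \<in> \<G> \<Longrightarrow> X \<in> sets M"
  using \<G>_sets by blast

text \<open>Domination by a multiple of the measure makes a charge countably additive.\<close>

definition charge :: "('a set \<Rightarrow> real) \<Rightarrow> bool" where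
  "charge \<alpha> \<longleftrightarrow> (\<exists>c. \<forall>X\<in>\<G>. 0 \<le> \<alpha> X \<and> \<alpha> X \<le> c * measure M X) \<and>
    (\<forall>X\<in>\<G>. \<forall>Y\<in>\<G>. X \<inter> Y = {} \<longrightarrow> \<alpha> (X \<union> Y) = \<alpha> X + \<alpha> Y)"

lemma charge_add: "charge \<alpha> \<Longrightarrow> charge \<beta> \<Longrightarrow> charge (\<lambda>X. \<alpha> X + \<beta> X)"
  unfolding charge_def
proof (elim conjE exE, intro conjI)
  fix c d assume "\<forall>X\<in>\<G>. 0 \<le> \<alpha> X \<and> \<alpha> X \<le> c * measure M X" "\<forall>X\<in>\<G>. 0 \<le> \<beta> X \<and> \<beta> X \<le> d * measure M X"
  then show "\<exists>c. \<forall>X\<in>\<G>. 0 \<le> \<alpha> X + \<beta> X \<and> \<alpha> X + \<beta> X \<le> c * measure M X"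
    by (intro exI[of _ "c + d"]) (auto simp: distrib_right intro!: add_mono)
qed auto

lemma charge_scale: "charge \<alpha> \<Longrightarrow> r \<ge> 0 \<Longrightarrow> charge (\<lambda>X. r * \<alpha> X)"
  unfolding charge_def
proof (elim conjE exE, intro conjI)
  fix c assume "\<forall>X\<in>\<G>. 0 \<le> \<alpha> X \<and> \<alpha> X \<le> c * measure M X" "r \<ge> 0"
  then show "\<exists>c. \<forall>X\<in>\<G>. 0 \<le> r * \<alpha> X \<and> r * \<alpha> X \<le> c * measure M X"
    by (intro exI[of _ "r * c"]) (auto simp: mult.assoc intro!: mult_left_mono)
qed (auto simp: distrib_left)

lemma charge_measure:
  assumes "B \<in> sets M"
  shows "charge (\<lambda>X. measure M (B \<inter> X))"
  unfolding charge_def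
proof (intro conjI ballI impI)
  show "\<exists>c. \<forall>X\<in>\<G>. 0 \<le> measure M (B \<inter> X) \<and> measure M (B \<inter> X) \<le> c * measure M X"
    by (intro exI[of _ 1]) (auto intro!: finite_measure_mono)
  show "measure M (B \<inter> (X \<union> Y)) = measure M (B \<inter> X) + measure M (B \<inter> Y)"
    if "X \<in> \<G>" "Y \<in> \<G>" "X \<inter> Y = {}" for X Y
    unfolding Int_Un_distrib using that assms by (intro finite_measure_Union) auto
qed

lemma charge_split:
  assumes "charge \<alpha>" "X \<in> \<G>" "Y \<in> \<G>"
  shows "\<alpha> X = \<alpha> (X \<inter> Y) + \<alpha> (X - Y)"
proof -
  have "\<alpha> ((X \<inter> Y) \<union> (X - Y)) = \<alpha> (X \<inter> Y) + \<alpha> (X - Y)"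
    using assms(1) unfolding charge_def
    by (elim conjE) (drule bspec[OF _ \<G>_Int[OF assms(2,3)]], drule bspec[OF _ \<G>_Diff[OF assms(2,3)]], auto)
  then show ?thesis by (simp add: Int_Diff_Un)
qed

lemma charge_extends:
  assumes \<alpha>: "charge \<alpha>"
  obtains N where "sets N = \<G>" "finite_measure N" "\<And>X. X \<in> \<G> \<Longrightarrow> measure N X = \<alpha> X"
proof -
  obtain c where c: "\<And>X. X \<in> \<G> \<Longrightarrow> 0 \<le> \<alpha> X" "\<And>X. X \<in> \<G> \<Longrightarrow> \<alpha> X \<le> c * measure M X"
    using \<alpha> unfolding charge_def by blast
  have \<alpha>_add: "\<alpha> (X \<union> Y) = \<alpha> X + \<alpha> Y" if "X \<in> \<G>" "Y \<in> \<G>" "X \<inter> Y = {}" for X Y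
    using \<alpha> that unfolding charge_def by blast
  let ?f = "\<lambda>X. ennreal (\<alpha> X)"
  have "\<alpha> {} = 0"
    using c[OF \<G>_empty] by simp
  then have pos: "positive \<G> ?f"
    by (simp add: positive_def)
  have "countably_additive \<G> ?f"
  proof (rule ring_of_sets.empty_continuous_imp_countably_additive[OF _ pos])
    show "ring_of_sets (space M) \<G>"
      using sigma_\<G> by (simp add: sigma_algebra_def algebra_def)
    show "additive \<G> ?f"
      using c by (auto simp: additive_def \<alpha>_add)
    show "(\<lambda>i. ennreal (\<alpha> (A i))) \<longlonglongrightarrow> 0"
      if A: "range A \<subseteq> \<G>" "decseq A" "(\<Inter>i. A i) = {}" for A :: "nat \<Rightarrow> 'a set"
    proof -
      have "(\<lambda>i. measure M (A i)) \<longlonglongrightarrow> measure M (\<Inter>i. A i)"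
        using A \<G>_sets by (intro finite_Lim_measure_decseq) auto
      then have "(\<lambda>i. c * measure M (A i)) \<longlonglongrightarrow> c * 0"
        using A by (intro tendsto_intros) simp
      then have lim: "(\<lambda>i. c * measure M (A i)) \<longlonglongrightarrow> 0"
        by simp
      have "A n \<in> \<G>" for n using A by blast
      then have "(\<lambda>i. \<alpha> (A i)) \<longlonglongrightarrow> 0"
        by (intro tendsto_sandwich[OF _ _ tendsto_const lim] always_eventually allI c)
      then show ?thesis
        using tendsto_ennrealI[of _ 0] by fastforce
    qed
  qed auto
  then have em: "emeasure (measure_of (space M) \<G> ?f) X = ?f X" if "X \<in> \<G>" for X
    using that pos sigma_\<G> by (intro emeasure_measure_of_sigma)
  show thesis
  proof
    show "sets (measure_of (space M) \<G> ?f) = \<G>"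
      by (rule sigma_algebra.sets_measure_of_eq[OF sigma_\<G>])
    show "finite_measure (measure_of (space M) \<G> ?f)"
      using em[OF \<G>_space] by (intro finite_measureI) (simp add: space_measure_of_conv)
    show "measure (measure_of (space M) \<G> ?f) X = \<alpha> X" if "X \<in> \<G>" for X
      using em[OF that] c that by (simp add: measure_def)
  qed
qed

text \<open>The decomposition is that of two measures on \<G> itself, so \<open>Y\<close> belongs to
  \<G>; it locates where one conditional density is below the other.\<close>

lemma charge_Hahn:
  assumes "charge \<alpha>" "charge \<beta>"
  obtains Y where "Y \<in> \<G>" "\<forall>X\<in>\<G>. X \<subseteq> Y \<longrightarrow> \<alpha> X \<le> \<beta> X"
    "\<forall>X\<in>\<G>. X \<inter> Y = {} \<longrightarrow> \<beta> X \<le> \<alpha> X"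
proof -
  obtain N1 where N1: "sets N1 = \<G>" "finite_measure N1" "\<And>X. X \<in> \<G> \<Longrightarrow> measure N1 X = \<alpha> X"
    using charge_extends[OF assms(1)] by blast
  obtain N2 where N2: "sets N2 = \<G>" "finite_measure N2" "\<And>X. X \<in> \<G> \<Longrightarrow> measure N2 X = \<beta> X"
    using charge_extends[OF assms(2)] by blast
  have le: "emeasure N1 X \<le> emeasure N2 X \<longleftrightarrow> \<alpha> X \<le> \<beta> X"
       "emeasure N2 X \<le> emeasure N1 X \<longleftrightarrow> \<beta> X \<le> \<alpha> X" if "X \<in> \<G>" for X
    using that N1 N2 by (auto simp: finite_measure.emeasure_eq_measure simp flip: N1(3) N2(3))
  have "\<exists>Y\<in>\<G>. (\<forall>X\<in>\<G>. X \<subseteq> Y \<longrightarrow> emeasure N1 X \<le> emeasure N2 X) \<and>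
      (\<forall>X\<in>\<G>. X \<inter> Y = {} \<longrightarrow> emeasure N2 X \<le> emeasure N1 X)"
    using finite_unsigned_Hahn_decomposition[OF N2(2) N1(2)] N1(1) N2(1) by simp
  then show thesis using le by (elim bexE conjE) (rule that, simp_all)
qed

text \<open>Let \<open>F0\<close> be no trace, and \<open>Y\<close> in \<G> a Hahn set on which
  \<open>F0\<close> has at most the conditional measure of \<open>A - F0\<close>, and off which it
  has at least that much. \<open>F\<close> takes the smaller one on each side. It is the symmetric
  difference of \<open>F0\<close> and the trace of \<open>space M - Y\<close>, hence not
  null.\<close>

lemma half_subset:
  assumes A: "A \<in> sets M" "measure M A > 0"
  shows "\<exists>F\<in>sets M. F \<subseteq> A \<and> measure M F > 0 \<and> (\<forall>X\<in>\<G>. measure M (F \<inter> X) \<le> measure M (A \<inter> X) / 2)"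
proof -
  obtain F0 where F0: "F0 \<in> sets M" "F0 \<subseteq> A"
      "\<And>G. G \<in> \<G> \<Longrightarrow> measure M ((F0 - G) \<union> (A \<inter> G - F0)) > 0"
    using not_trace[OF A] by blast
  have AF: "A - F0 \<in> sets M" using A F0 by auto
  obtain Y where Y: "Y \<in> \<G>"
      "\<forall>X\<in>\<G>. X \<subseteq> Y \<longrightarrow> measure M (F0 \<inter> X) \<le> measure M ((A - F0) \<inter> X)"
      "\<forall>X\<in>\<G>. X \<inter> Y = {} \<longrightarrow> measure M ((A - F0) \<inter> X) \<le> measure M (F0 \<inter> X)"
    by (rule charge_Hahn[OF charge_measure[OF F0(1)] charge_measure[OF AF]])
  define F where "F = (F0 \<inter> Y) \<union> ((A - F0) - Y)"
  have sub: "F0 \<subseteq> space M" "A \<subseteq> space M" using sets.sets_into_space[OF F0(1)] sets.sets_into_space[OF A(1)] by auto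
  have split: "measure M (A \<inter> X) = measure M (F0 \<inter> X) + measure M ((A - F0) \<inter> X)" if "X \<in> sets M" for X
  proof -
    have "A \<inter> X = (F0 \<inter> X) \<union> ((A - F0) \<inter> X)" using F0 by auto
    then show ?thesis
      using that F0 AF by (simp, intro finite_measure_Union) auto
  qed
  show ?thesis
  proof (intro bexI[of _ F] conjI ballI)
    show F: "F \<in> sets M"
      unfolding F_def using F0(1) A(1) \<G>_in[OF Y(1)] by (intro sets.Un sets.Int sets.Diff)
    show "F \<subseteq> A" using F0 by (auto simp: F_def)
    have "(F0 - (space M - Y)) \<union> (A \<inter> (space M - Y) - F0) = F"
      using sub by (auto simp: F_def)
    then show "measure M F > 0"
      using F0(3)[OF \<G>_Diff[OF \<G>_space Y(1)]] by simp
    fix X assume X: "X \<in> \<G>"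
    have "measure M (F \<inter> X) = measure M (F \<inter> (X \<inter> Y)) + measure M (F \<inter> (X - Y))"
      using charge_split[OF charge_measure[OF F] X Y(1)] .
    also have "F \<inter> (X \<inter> Y) = F0 \<inter> (X \<inter> Y)" by (auto simp: F_def)
    also have "F \<inter> (X - Y) = (A - F0) \<inter> (X - Y)" by (auto simp: F_def)
    also have "measure M (F0 \<inter> (X \<inter> Y)) \<le> measure M (A \<inter> (X \<inter> Y)) / 2"
      using Y(2)[rule_format, OF \<G>_Int[OF X Y(1)]] split[of "X \<inter> Y"] X Y(1) by (simp add: \<G>_Int)
    also have "measure M ((A - F0) \<inter> (X - Y)) \<le> measure M (A \<inter> (X - Y)) / 2"
      using Y(3)[rule_format, OF \<G>_Diff[OF X Y(1)]] split[of "X - Y"] X Y(1) by (auto simp: \<G>_Diff)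
    finally show "measure M (F \<inter> X) \<le> measure M (A \<inter> X) / 2"
      using charge_split[OF charge_measure[OF A(1)] X Y(1)] by simp
  qed
qed

lemma small_subset:
  assumes "A \<in> sets M" "measure M A > 0"
  shows "\<exists>F\<in>sets M. F \<subseteq> A \<and> measure M F > 0 \<and> (\<forall>X\<in>\<G>. measure M (F \<inter> X) \<le> measure M (A \<inter> X) / 2 ^ n)"
proof (induction n)
  case 0
  then show ?case using assms by auto
next
  case (Suc n)
  then obtain F where F: "F \<in> sets M" "F \<subseteq> A" "measure M F > 0"
      "\<And>X. X \<in> \<G> \<Longrightarrow> measure M (F \<inter> X) \<le> measure M (A \<inter> X) / 2 ^ n"
    by blast
  obtain F' where F': "F' \<in> sets M" "F' \<subseteq> F" "measure M F' > 0"
      "\<And>X. X \<in> \<G> \<Longrightarrow> measure M (F' \<inter> X) \<le> measure M (F \<inter> X) / 2"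
    using half_subset[OF F(1,3)] by blast
  have "measure M (F' \<inter> X) \<le> measure M (A \<inter> X) / 2 ^ Suc n" if "X \<in> \<G>" for X
  proof -
    have "measure M (F' \<inter> X) \<le> (measure M (A \<inter> X) / 2 ^ n) / 2"
      by (rule order_trans[OF F'(4)[OF that] divide_right_mono[OF F(4)[OF that]]]) simp
    then show ?thesis by (simp add: mult.commute)
  qed
  then show ?case using F F' by blast
qed

text \<open>A conditional form of Sierpinski's theorem on the range of an atomless measure.
  \<open>C\<close> is chosen so that no larger subset of \<open>B\<close> staying below \<nu> has
  larger measure.\<close>

theorem subset_with_conditional_measure:
  assumes B: "B \<in> sets M" and \<nu>: "charge \<nu>" and le: "\<And>X. X \<in> \<G> \<Longrightarrow> \<nu> X \<le> measure M (B \<inter> X)"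
  shows "\<exists>C\<in>sets M. C \<subseteq> B \<and> (\<forall>X\<in>\<G>. measure M (C \<inter> X) = \<nu> X)"
proof -
  define \<S> where "\<S> = {C \<in> sets M. C \<subseteq> B \<and> (\<forall>X\<in>\<G>. measure M (C \<inter> X) \<le> \<nu> X)}"
  have \<nu>_nonneg: "\<nu> X \<ge> 0" if "X \<in> \<G>" for X
    using \<nu> that by (auto simp: charge_def)
  have "\<exists>C\<in>\<S>. {} \<subseteq> C \<and> (\<forall>C'\<in>\<S>. C \<subseteq> C' \<longrightarrow> measure M C' = measure M C)"
  proof (rule ordering_principle)
    show "{} \<in> \<S>" using \<nu>_nonneg by (auto simp: \<S>_def)
    show "\<exists>u\<in>\<S>. \<forall>n. s n \<subseteq> u" if s: "\<And>n. s n \<in> \<S>" "\<And>n. s n \<subseteq> s (Suc n)" for s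
    proof (intro bexI allI)
      have "measure M ((\<Union>n. s n) \<inter> X) \<le> \<nu> X" if X: "X \<in> \<G>" for X
      proof (rule LIMSEQ_le_const2)
        have "incseq (\<lambda>n. s n \<inter> X)"
          using s(2) by (intro incseq_SucI) blast
        then have "(\<lambda>n. measure M (s n \<inter> X)) \<longlonglongrightarrow> measure M (\<Union>n. s n \<inter> X)"
          using s(1) X by (intro finite_Lim_measure_incseq) (auto simp: \<S>_def)
        then show "(\<lambda>n. measure M (s n \<inter> X)) \<longlonglongrightarrow> measure M ((\<Union>n. s n) \<inter> X)"
          by simp
        show "\<exists>N. \<forall>n\<ge>N. measure M (s n \<inter> X) \<le> \<nu> X"
          using s(1) X by (auto simp: \<S>_def)
      qed
      then show "(\<Union>n. s n) \<in> \<S>"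
        using s(1) unfolding \<S>_def by blast
    qed auto
    show "measure M x \<le> measure M y" if "x \<in> \<S>" "y \<in> \<S>" "x \<subseteq> y" for x y
      using that by (intro finite_measure_mono) (auto simp: \<S>_def)
    show "bdd_above (measure M ` \<S>)"
      by (intro bdd_aboveI2[where M="measure M (space M)"] bounded_measure)
  qed auto
  then obtain C where C: "C \<in> \<S>" and max: "\<And>C'. C' \<in> \<S> \<Longrightarrow> C \<subseteq> C' \<Longrightarrow> measure M C' = measure M C"
    by blast
  have Cs: "C \<in> sets M" "C \<subseteq> B" "\<And>X. X \<in> \<G> \<Longrightarrow> measure M (C \<inter> X) \<le> \<nu> X"
    using C by (auto simp: \<S>_def)
  \<comment> \<open>If \<open>C\<close> falls short of \<open>\<nu>\<close> on \<open>X0\<close>, a Hahn set \<open>Y\<close> on which the deficit exceeds \<open>e\<close> times the measure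
    leaves room for a small piece \<open>F\<close> of \<open>B - C\<close>.\<close>
  have "measure M (C \<inter> X0) = \<nu> X0" if X0: "X0 \<in> \<G>" for X0
  proof (rule ccontr)
    assume "measure M (C \<inter> X0) \<noteq> \<nu> X0"
    then have gap: "\<nu> X0 - measure M (C \<inter> X0) > 0"
      using Cs(3)[OF X0] by simp
    \<comment> \<open>The exponent serves twice: \<open>e = (1/2) ^ n\<close> is a density that fits
      into the deficit on \<open>X0\<close>, and a piece from \<open>small_subset\<close> at the
      same \<open>n\<close> adds at most \<open>e\<close> times the measure of any set in
      \<G>.\<close>
    obtain n where n: "(1/2) ^ n < (\<nu> X0 - measure M (C \<inter> X0)) / (measure M X0 + 1)"
      using real_arch_pow_inv[of "(\<nu> X0 - measure M (C \<inter> X0)) / (measure M X0 + 1)" "1/2"] gap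
      by (auto simp: add_nonneg_pos)
    define e :: real where "e = (1/2) ^ n"
    have e: "e > 0" by (simp add: e_def)
    have eX0: "e * measure M X0 < \<nu> X0 - measure M (C \<inter> X0)"
    proof -
      have "e * (measure M X0 + 1) < \<nu> X0 - measure M (C \<inter> X0)"
        using n by (simp add: e_def pos_less_divide_eq add_nonneg_pos)
      moreover have "e * (measure M X0 + 1) = e * measure M X0 + e" by (simp add: algebra_simps)
      ultimately show ?thesis using e by linarith
    qed
    have ch: "charge (\<lambda>X. measure M (C \<inter> X) + e * measure M (space M \<inter> X))"
      using e by (intro charge_add charge_scale charge_measure Cs) auto
    obtain Y where Y: "Y \<in> \<G>"
        "\<forall>X\<in>\<G>. X \<subseteq> Y \<longrightarrow> measure M (C \<inter> X) + e * measure M (space M \<inter> X) \<le> \<nu> X"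
        "\<forall>X\<in>\<G>. X \<inter> Y = {} \<longrightarrow> \<nu> X \<le> measure M (C \<inter> X) + e * measure M (space M \<inter> X)"
      by (rule charge_Hahn[OF ch \<nu>])
    have sp: "space M \<inter> X = X" if "X \<in> \<G>" for X
      using sets.sets_into_space[OF \<G>_in[OF that]] by auto
    define Z where "Z = X0 \<inter> Y"
    have Z: "Z \<in> \<G>" unfolding Z_def using X0 Y(1) by (rule \<G>_Int)
    have D: "X0 - Y \<in> \<G>" using X0 Y(1) by (rule \<G>_Diff)
    \<comment> \<open>Off \<open>Y\<close> the deficit is at most \<open>e\<close> times the
      measure, which by \<open>eX0\<close> is less than the deficit on \<open>X0\<close>; the
      remainder sits on \<open>Z\<close>.\<close>
    have "\<nu> Z - measure M (C \<inter> Z) > 0"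
    proof -
      have "\<nu> (X0 - Y) \<le> measure M (C \<inter> (X0 - Y)) + e * measure M (X0 - Y)"
        using Y(3)[rule_format, OF D] sp[OF D] by auto
      moreover have "e * measure M (X0 - Y) \<le> e * measure M X0"
        using e X0 by (intro mult_left_mono finite_measure_mono) auto
      ultimately show ?thesis
        using eX0 charge_split[OF \<nu> X0 Y(1)] charge_split[OF charge_measure[OF Cs(1)] X0 Y(1)]
        unfolding Z_def by linarith
    qed
    moreover have "measure M (B \<inter> Z) = measure M (C \<inter> Z) + measure M ((B - C) \<inter> Z)"
    proof -
      have "B \<inter> Z = (C \<inter> Z) \<union> ((B - C) \<inter> Z)" using Cs by auto
      then show ?thesis using Cs B Z by (simp, intro finite_measure_Union) auto
    qed
    ultimately have pos: "measure M ((B - C) \<inter> Z) > 0"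
      using le[OF Z] by linarith
    have BCZ: "(B - C) \<inter> Z \<in> sets M"
      by (rule sets.Int[OF sets.Diff[OF B Cs(1)] \<G>_in[OF Z]])
    obtain F where F: "F \<in> sets M" "F \<subseteq> (B - C) \<inter> Z" "measure M F > 0"
        "\<forall>X\<in>\<G>. measure M (F \<inter> X) \<le> measure M ((B - C) \<inter> Z \<inter> X) / 2 ^ n"
      using small_subset[OF BCZ pos, of n] by (elim bexE conjE) (rule that)
    have "measure M ((C \<union> F) \<inter> X) \<le> \<nu> X" if X: "X \<in> \<G>" for X
    proof -
      have CF: "measure M ((C \<union> F) \<inter> X') = measure M (C \<inter> X') + measure M (F \<inter> X')" if "X' \<in> \<G>" for X'
        unfolding Int_Un_distrib2 using F Cs that by (intro finite_measure_Union) auto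
      have XZ: "X \<inter> Z \<in> \<G>" "X - Z \<in> \<G>" using X Z by (auto simp: \<G>_Int \<G>_Diff)
      have "measure M (F \<inter> (X \<inter> Z)) \<le> measure M ((B - C) \<inter> Z \<inter> (X \<inter> Z)) / 2 ^ n"
        by (rule F(4)[rule_format, OF XZ(1)])
      also have "\<dots> \<le> measure M (X \<inter> Z) / 2 ^ n"
        using XZ by (intro divide_right_mono finite_measure_mono) auto
      also have "\<dots> = e * measure M (X \<inter> Z)"
        by (simp add: e_def power_one_over)
      finally have FXZ: "measure M (F \<inter> (X \<inter> Z)) \<le> e * measure M (X \<inter> Z)" .
      have "X \<inter> Z \<subseteq> Y" by (auto simp: Z_def)
      from Y(2)[rule_format, OF XZ(1) this]
      have "measure M ((C \<union> F) \<inter> (X \<inter> Z)) \<le> \<nu> (X \<inter> Z)"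
        using CF[OF XZ(1)] sp[OF XZ(1)] FXZ by simp
      moreover have "F \<inter> (X - Z) = {}" using F by auto
      then have "measure M ((C \<union> F) \<inter> (X - Z)) \<le> \<nu> (X - Z)"
        using CF[OF XZ(2)] Cs(3)[OF XZ(2)] by simp
      moreover have "C \<union> F \<in> sets M" using F Cs by auto
      ultimately show ?thesis
        using charge_split[OF \<nu> X Z] charge_split[OF charge_measure X Z] by simp
    qed
    then have "C \<union> F \<in> \<S>"
      using F Cs by (auto simp: \<S>_def)
    then have "measure M (C \<union> F) = measure M C"
      using max by blast
    moreover have "measure M (C \<union> F) = measure M C + measure M F"
      using F Cs by (intro finite_measure_Union) auto
    ultimately show False using F(3) by simp
  qed
  then show ?thesis using Cs by blast
qed

end

subsection \<open>Cluster points of sequences of functions\<close>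

text \<open>A substitute for an ultrafilter; it makes uncountably many bounded sequences converge at once.\<close>

lemma bounded_convergence_filter:
  obtains F :: "nat filter" where "F \<noteq> bot" "F \<le> sequentially"
    "\<And>s :: nat \<Rightarrow> real. Bseq s \<Longrightarrow> \<exists>l. (s \<longlongrightarrow> l) F"
proof -
  define b where "b s = (SOME b. \<forall>n. norm (s n :: real) \<le> b)" for s :: "nat \<Rightarrow> real"
  have b: "\<bar>s n\<bar> \<le> b s" if "Bseq s" for s n
  proof -
    have "\<exists>b. \<forall>n. norm (s n) \<le> b"
      using that by (auto simp: Bseq_def)
    from someI_ex[OF this] show ?thesis
      by (auto simp: b_def)
  qed
  \<comment> \<open>Each \<open>n\<close> becomes a point of a Tychonoff cube with one coordinate
    for every real sequence, the coordinates of unbounded sequences being 0. \<open>F\<close> is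
    built so that \<open>ev\<close> converges along it to a cluster point of these points.\<close>
  define ev :: "nat \<Rightarrow> (nat \<Rightarrow> real) \<Rightarrow> real" where "ev n s = (if Bseq s then s n else 0)" for n s
  define C where "C = PiE UNIV (\<lambda>s. if Bseq s then {- b s..b s} else {0})"
  have ev_C: "ev n \<in> C" for n
    using b by (auto simp: ev_def C_def abs_le_iff minus_le_iff)
  have "compactin (product_topology (\<lambda>_. euclidean) UNIV) C"
    unfolding C_def by (auto simp: compactin_PiE)
  then have "compact C"
    by (simp add: euclidean_product_topology)
  moreover have "filtermap ev sequentially \<noteq> bot"
    by (simp add: filtermap_bot_iff)
  moreover have "eventually (\<lambda>x. x \<in> C) (filtermap ev sequentially)"
    using ev_C by (auto simp: eventually_filtermap)
  ultimately obtain x where x: "inf (nhds x) (filtermap ev sequentially) \<noteq> bot"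
    unfolding compact_filter by blast
  define F where "F = inf sequentially (filtercomap ev (nhds x))"
  have "F \<noteq> bot"
  proof
    assume "F = bot"
    then have "eventually (\<lambda>_. False) F" by simp
    then obtain P Q where P: "eventually P sequentially" and Q: "eventually Q (nhds x)"
      and PQ: "\<And>n. P n \<Longrightarrow> \<not> Q (ev n)"
      unfolding F_def eventually_inf eventually_filtercomap by blast
    have "eventually (\<lambda>y. \<not> Q y) (filtermap ev sequentially)"
      unfolding eventually_filtermap using P by eventually_elim (rule PQ)
    with Q have "eventually (\<lambda>_. False) (inf (nhds x) (filtermap ev sequentially))"
      unfolding eventually_inf by blast
    then show False using x by (simp add: trivial_limit_def)
  qed
  moreover have "F \<le> sequentially" by (simp add: F_def)
  moreover have "(s \<longlongrightarrow> x s) F" if "Bseq s" for s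
  proof -
    have "(ev \<longlongrightarrow> x) F"
      unfolding F_def by (rule filterlim_mono[OF filterlim_filtercomap]) auto
    then have "((\<lambda>n. ev n s) \<longlongrightarrow> x s) F"
      using continuous_on_tendsto_compose[OF continuous_on_product_coordinates[of s]] by simp
    then show ?thesis using that by (simp add: ev_def)
  qed
  ultimately show ?thesis using that by blast
qed

section \<open>Nested binary partitions of the agents and of the compact set\<close>

text \<open>Lists of length \<open>k\<close> index a partition of \<open>T []\<close>. The notion
  covers both the preimages of cells under each \<open>f n\<close> and the sets that imitate them in
  the limit, so one integral estimate serves both.\<close>

definition binary_tree :: "(bool list \<Rightarrow> 's set) \<Rightarrow> bool" where
  "binary_tree T \<longleftrightarrow> (\<forall>\<sigma>. T \<sigma> = T (True # \<sigma>) \<union> T (False # \<sigma>) \<and> T (True # \<sigma>) \<inter> T (False # \<sigma>) = {})"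

lemma binary_tree_children:
  assumes "binary_tree T"
  shows "s \<in> T \<sigma> \<longleftrightarrow> s \<in> T (True # \<sigma>) \<or> s \<in> T (False # \<sigma>)"
    and "s \<in> T (True # \<sigma>) \<Longrightarrow> s \<notin> T (False # \<sigma>)"
    and "s \<in> T (b # \<sigma>) \<Longrightarrow> s \<in> T \<sigma>"
proof -
  have eq: "T \<sigma> = T (True # \<sigma>) \<union> T (False # \<sigma>)" and dj: "T (True # \<sigma>) \<inter> T (False # \<sigma>) = {}"
    using assms unfolding binary_tree_def by (metis, metis)
  show "s \<in> T \<sigma> \<longleftrightarrow> s \<in> T (True # \<sigma>) \<or> s \<in> T (False # \<sigma>)"
    by (subst eq) (rule Un_iff)
  then show "s \<in> T (b # \<sigma>) \<Longrightarrow> s \<in> T \<sigma>"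
    by (cases b) simp_all
  show "s \<in> T (True # \<sigma>) \<Longrightarrow> s \<notin> T (False # \<sigma>)"
    using dj by blast
qed

lemma binary_tree_branch:
  assumes T: "binary_tree T" and s: "s \<in> T []"
  obtains p where "\<And>k. length (p k) = k" "\<And>k. s \<in> T (p k)" "\<And>\<sigma>. s \<in> T \<sigma> \<Longrightarrow> \<sigma> = p (length \<sigma>)"
    "\<And>k. \<exists>b. p (Suc k) = b # p k"
proof -
  define p where "p = rec_nat [] (\<lambda>_ \<sigma>. (s \<in> T (True # \<sigma>)) # \<sigma>)"
  have p: "p 0 = []" "\<And>k. p (Suc k) = (s \<in> T (True # p k)) # p k"
    by (auto simp: p_def)
  have in_T: "s \<in> T (p k)" for k
  proof (induction k)
    case (Suc k)
    then show ?case
      using binary_tree_children(1)[OF T, of s "p k"] by (cases "s \<in> T (True # p k)") (simp_all add: p)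
  qed (simp add: p s)
  have "\<sigma> = p (length \<sigma>)" if "s \<in> T \<sigma>" for \<sigma>
    using that
  proof (induction \<sigma>)
    case (Cons b \<sigma>)
    then have "\<sigma> = p (length \<sigma>)" using binary_tree_children(3)[OF T] by blast
    moreover have "b = (s \<in> T (True # \<sigma>))"
      using Cons.prems binary_tree_children(2)[OF T] by (cases b) auto
    ultimately show ?case by (simp add: p)
  qed (simp add: p)
  moreover have "length (p k) = k" for k by (induction k) (simp_all add: p)
  ultimately show thesis using that in_T p by blast
qed

lemma finite_bool_lists: "finite {\<sigma> :: bool list. length \<sigma> = k}"
  using finite_lists_length_eq[of "UNIV :: bool set" k] by simp

lemma binary_tree_sum:
  fixes a :: "bool list \<Rightarrow> real"
  assumes T: "binary_tree T" and s: "s \<in> T \<sigma>"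
  shows "(\<Sum>\<tau> | length \<tau> = length \<sigma>. a \<tau> * indicator (T \<tau>) s) = a \<sigma>"
proof -
  have "s \<in> T []"
    using s by (induction \<sigma>) (auto dest: binary_tree_children(3)[OF T])
  then obtain p where p: "\<And>\<tau>. s \<in> T \<tau> \<Longrightarrow> \<tau> = p (length \<tau>)"
    using binary_tree_branch[OF T] by metis
  have "a \<tau> * indicator (T \<tau>) s = (if \<tau> = \<sigma> then a \<sigma> else 0)" if "length \<tau> = length \<sigma>" for \<tau>
  proof (cases "s \<in> T \<tau>")
    case True
    then have "\<tau> = \<sigma>" using p[OF True] p[OF s] that by simp
    then show ?thesis using s by simp
  next
    case False
    then show ?thesis using s by auto
  qed
  then have "(\<Sum>\<tau> | length \<tau> = length \<sigma>. a \<tau> * indicator (T \<tau>) s)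
      = (\<Sum>\<tau> | length \<tau> = length \<sigma>. if \<tau> = \<sigma> then a \<sigma> else 0)"
    by (intro sum.cong) auto
  also have "\<dots> = a \<sigma>"
    by (subst sum.delta) (auto simp: finite_bool_lists)
  finally show ?thesis .
qed

text \<open>Up to a controlled error the integral depends only on the measures of the
  level-\<open>k\<close> sets, which are the quantities known to converge when the lemma is
  applied.\<close>

lemma (in finite_measure) binary_tree_integral:
  fixes \<phi> :: "'a \<Rightarrow> real"
  assumes T: "binary_tree T" "T [] = space M" "\<And>\<sigma>. T \<sigma> \<in> sets M"
    and \<phi> [measurable]: "\<phi> \<in> borel_measurable M"
    and close: "AE t in M. \<forall>\<sigma>. length \<sigma> = k \<longrightarrow> t \<in> T \<sigma> \<longrightarrow> \<bar>\<phi> t - a \<sigma>\<bar> \<le> \<epsilon>"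
  shows "\<bar>(\<integral>t. \<phi> t \<partial>M) - (\<Sum>\<sigma> | length \<sigma> = k. a \<sigma> * measure M (T \<sigma>))\<bar> \<le> \<epsilon> * measure M (space M)"
proof -
  define s where "s t = (\<Sum>\<sigma> | length \<sigma> = k. a \<sigma> * indicator (T \<sigma>) t)" for t
  have s_int: "integrable M s"
    unfolding s_def using T(3) by (intro Bochner_Integration.integrable_sum integrable_mult_right)
      (auto simp: emeasure_eq_measure)
  have s_I: "(\<integral>t. s t \<partial>M) = (\<Sum>\<sigma> | length \<sigma> = k. a \<sigma> * measure M (T \<sigma>))"
    unfolding s_def using T(3)
    by (subst Bochner_Integration.integral_sum)
      (auto simp: emeasure_eq_measure Int_absorb2 sets.sets_into_space)
  have [measurable]: "s \<in> borel_measurable M" using s_int by auto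
  have near: "AE t in M. \<bar>\<phi> t - s t\<bar> \<le> \<epsilon>"
    using close AE_space[of M]
  proof eventually_elim
    case (elim t)
    obtain p where p: "\<And>k. length (p k) = k" "\<And>k. t \<in> T (p k)"
      using binary_tree_branch[OF T(1), of t] elim T(2) by metis
    have "s t = a (p k)"
      using binary_tree_sum[OF T(1) p(2)[of k], of a] p(1) by (simp add: s_def)
    then show ?case using elim(1) p by auto
  qed
  have d_int: "integrable M (\<lambda>t. \<phi> t - s t)"
    by (rule integrable_const_bound[where B=\<epsilon>]) (use near in auto)
  have \<phi>_int: "integrable M \<phi>"
    using Bochner_Integration.integrable_add[OF d_int s_int] by simp
  have "\<bar>(\<integral>t. \<phi> t \<partial>M) - (\<integral>t. s t \<partial>M)\<bar> = \<bar>\<integral>t. \<phi> t - s t \<partial>M\<bar>"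
    using \<phi>_int s_int by simp
  also have "\<dots> \<le> (\<integral>t. \<bar>\<phi> t - s t\<bar> \<partial>M)"
    by (rule integral_abs_bound)
  also have "\<dots> \<le> (\<integral>t. \<epsilon> \<partial>M)"
    using d_int near by (intro integral_mono_AE) auto
  finally show ?thesis by (simp add: s_I mult.commute)
qed

text \<open>Bit strings are read from the right: the most recent bit is the head of the list.\<close>

primrec cell :: "(nat \<Rightarrow> 'b set) \<Rightarrow> bool list \<Rightarrow> 'b set" where
  "cell U [] = UNIV"
| "cell U (b # \<sigma>) = cell U \<sigma> \<inter> (if b then U (length \<sigma>) else - U (length \<sigma>))"

lemma cell_same_side: "x \<in> cell U \<sigma> \<Longrightarrow> y \<in> cell U \<sigma> \<Longrightarrow> j < length \<sigma> \<Longrightarrow> x \<in> U j \<longleftrightarrow> y \<in> U j"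
  by (induction \<sigma>) (auto simp: less_Suc_eq split: if_splits)

text \<open>Finitely many basic sets of small oscillation cover \<open>K\<close>; once
  \<open>k\<close> exceeds their indices, two points of \<open>K\<close> in the same
  level-\<open>k\<close> cell lie in the same covering sets.\<close>

lemma cell_small_oscillation:
  fixes U :: "nat \<Rightarrow> 'b::metric_space set" and c :: "'b \<Rightarrow> real"
  assumes U: "topological_basis (range U)" and K: "compact K" and c: "continuous_on K c" and e: "e > 0"
  obtains k where "\<And>\<sigma> x y. length \<sigma> = k \<Longrightarrow> x \<in> K \<inter> cell U \<sigma> \<Longrightarrow> y \<in> K \<inter> cell U \<sigma> \<Longrightarrow> \<bar>c x - c y\<bar> < e"
proof -
  have "\<exists>j. x \<in> U j \<and> (\<forall>y\<in>K \<inter> U j. \<bar>c y - c x\<bar> < e / 2)" if x: "x \<in> K" for x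
  proof -
    obtain d where d: "d > 0" "\<And>y. y \<in> K \<Longrightarrow> dist y x < d \<Longrightarrow> dist (c y) (c x) < e / 2"
      using c x e unfolding continuous_on_iff by (meson half_gt_zero)
    obtain j where "x \<in> U j" "U j \<subseteq> ball x d"
      using topological_basisE[OF U open_ball[of x d], of x] d(1) by auto
    then show ?thesis using d(2) by (intro exI[of _ j]) (auto simp: dist_real_def dist_commute subset_iff)
  qed
  then obtain J where J: "\<And>x. x \<in> K \<Longrightarrow> x \<in> U (J x)" "\<And>x y. x \<in> K \<Longrightarrow> y \<in> K \<inter> U (J x) \<Longrightarrow> \<bar>c y - c x\<bar> < e / 2"
    by metis
  have "K \<subseteq> (\<Union>x\<in>K. U (J x))" using J by blast
  moreover have "open (U j)" for j
    using topological_basis_open[OF U] by blast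
  ultimately obtain K' where K': "K' \<subseteq> K" "finite K'" "K \<subseteq> (\<Union>x\<in>K'. U (J x))"
    using compactE_image[OF K, of K "\<lambda>x. U (J x)"] by metis
  define k where "k = Suc (Max (insert 0 (J ` K')))"
  have k: "J z < k" if "z \<in> K'" for z
    using that K'(2) by (auto simp: k_def less_Suc_eq_le intro!: Max_ge)
  show thesis
  proof
    fix \<sigma> x y assume \<sigma>: "length \<sigma> = k" and x: "x \<in> K \<inter> cell U \<sigma>" and y: "y \<in> K \<inter> cell U \<sigma>"
    obtain z where z: "z \<in> K'" "x \<in> U (J z)" using K' x by blast
    then have "y \<in> U (J z)"
      using cell_same_side[of x U \<sigma> y "J z"] x y k \<sigma> by auto
    then have "\<bar>c x - c z\<bar> < e / 2" "\<bar>c y - c z\<bar> < e / 2"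
      using J(2)[of z x] J(2)[of z y] z K' x y by auto
    then show "\<bar>c x - c y\<bar> < e" by linarith
  qed
qed

text \<open>\<open>l\<close> is a limit of points \<open>x (n k)\<close> picked in the successive
  cells of the branch through \<open>t\<close>. Cells need not be closed, so \<open>l\<close> may
  leave them; the last two conclusions let the branch alone decide whether \<open>l\<close> is in a
  given open set, which later yields measurability in \<open>t\<close>.\<close>

lemma branch_limit:
  fixes U :: "nat \<Rightarrow> 'b::metric_space set"
  assumes U: "\<And>j. open (U j)" and K: "compact K" and x: "\<And>n. x n \<in> K"
    and T: "binary_tree T" "t \<in> T []"
    and visits: "\<And>\<sigma> m. t \<in> T \<sigma> \<Longrightarrow> \<exists>n\<ge>m. x n \<in> cell U \<sigma>"
  obtains l where "l \<in> K" "\<And>m :: nat. l \<in> closure (x ` {m..})"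
    "\<And>\<sigma>. t \<in> T \<sigma> \<Longrightarrow> l \<in> closure (K \<inter> cell U \<sigma>)"
    "\<And>j. l \<in> U j \<Longrightarrow> \<exists>\<sigma>. t \<in> T \<sigma> \<and> cell U \<sigma> \<subseteq> U j"
proof -
  obtain p where p: "\<And>k. length (p k) = k" "\<And>k. t \<in> T (p k)" "\<And>\<sigma>. t \<in> T \<sigma> \<Longrightarrow> \<sigma> = p (length \<sigma>)"
    "\<And>k. \<exists>b. p (Suc k) = b # p k"
    using binary_tree_branch[OF T] by blast
  have anti: "cell U (p k') \<subseteq> cell U (p k)" if "k \<le> k'" for k k'
    using that
  proof (induction rule: dec_induct)
    case (step n)
    then show ?case using p(4)[of n] by auto
  qed auto
  have "\<forall>k. \<exists>n\<ge>k. x n \<in> cell U (p k)" using visits p(2) by blast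
  then obtain n where n: "\<And>k. n k \<ge> k" "\<And>k. x (n k) \<in> cell U (p k)" by metis
  obtain l r where l: "l \<in> K" "strict_mono r" "((\<lambda>k. x (n k)) \<circ> r) \<longlonglongrightarrow> l"
    using K x unfolding compact_def by metis
  have r: "k \<le> r k" for k using l(2) by (rule seq_suble)
  have ev: "l \<in> closure S" if "\<And>k. k \<ge> k0 \<Longrightarrow> x (n k) \<in> S" for S k0
  proof (rule Lim_in_closed_set[OF closed_closure _ _ l(3)])
    have "x (n (r k)) \<in> closure S" if "k \<ge> k0" for k
      using \<open>\<And>k. k \<ge> k0 \<Longrightarrow> x (n k) \<in> S\<close> r[of k] that closure_subset by (meson order_trans subsetD)
    then show "\<forall>\<^sub>F k in sequentially. ((\<lambda>k. x (n k)) \<circ> r) k \<in> closure S"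
      by (auto simp: eventually_sequentially)
  qed simp
  show thesis
  proof
    show "l \<in> K" by fact
    show "l \<in> closure (x ` {m..})" for m
      by (rule ev[of m]) (use n(1) order_trans in blast)
    show "l \<in> closure (K \<inter> cell U \<sigma>)" if "t \<in> T \<sigma>" for \<sigma>
      by (rule ev[of "length \<sigma>"]) (use n(2) x anti p(3)[OF that] in \<open>metis IntI subsetD\<close>)
    show "\<exists>\<sigma>. t \<in> T \<sigma> \<and> cell U \<sigma> \<subseteq> U j" if "l \<in> U j" for j
    proof -
      have "\<forall>\<^sub>F k in sequentially. x (n (r k)) \<in> U j"
        using topological_tendstoD[OF l(3) U that] by simp
      then obtain k0 where k0: "\<And>k. k \<ge> k0 \<Longrightarrow> x (n (r k)) \<in> U j"
        by (auto simp: eventually_sequentially)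
      define k where "k = max k0 (Suc j)"
      have "j < r k" using r[of k] by (simp add: k_def)
      then have "cell U (p (r k)) \<subseteq> U j"
        using k0[of k] n(2)[of "r k"] cell_same_side[of "x (n (r k))" U "p (r k)" _ j] p(1)
        by (auto simp: k_def)
      then show ?thesis using p(2) by blast
    qed
  qed
qed

section \<open>Measurable selection of cluster points\<close>

text \<open>The sets \<open>B \<sigma>\<close> have, on every set of \<G>, the limiting measure of
  the preimages \<open>S n \<sigma>\<close>, and \<open>h\<close> is read off from the branches of
  \<open>B\<close>. The measures on \<open>space M\<close> give convergence of integrals, those on
  the other sets of \<G> the clustering.\<close>

theorem saturated_limit_selection:
  fixes f :: "nat \<Rightarrow> 'a \<Rightarrow> 'b::{metric_space, second_countable_topology}"
  assumes sat: "saturated_measure M" and K: "compact K"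
    and f [measurable]: "\<And>n. f n \<in> borel_measurable M"
    and f_K: "\<And>n t. t \<in> space M \<Longrightarrow> f n t \<in> K"
    and F: "F \<noteq> bot" "F \<le> sequentially" "\<And>s :: nat \<Rightarrow> real. Bseq s \<Longrightarrow> \<exists>l. (s \<longlongrightarrow> l) F"
  obtains h where "h \<in> borel_measurable M" "h \<in> space M \<rightarrow> K"
    "AE t in M. \<forall>m. h t \<in> closure ((\<lambda>n. f n t) ` {m..})"
    "\<forall>c :: 'b \<Rightarrow> real. continuous_on K c \<longrightarrow> ((\<lambda>n. \<integral>t. c (f n t) \<partial>M) \<longlongrightarrow> (\<integral>t. c (h t) \<partial>M)) F"
proof -
  interpret finite_measure M
    using sat by (simp add: saturated_measure_def)
  obtain \<B> :: "'b set set" where \<B>: "countable \<B>" "topological_basis \<B>"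
    using ex_countable_basis by blast
  have "\<B> \<noteq> {}"
    using topological_basisE[OF \<B>(2) open_UNIV UNIV_I] by blast
  define U where "U = from_nat_into \<B>"
  have U_basis: "topological_basis (range U)"
    using \<B> \<open>\<B> \<noteq> {}\<close> by (simp add: U_def range_from_nat_into)
  have U_open: "open (U j)" for j
    using topological_basis_open[OF U_basis] by blast
  have cell_borel [measurable]: "cell U \<sigma> \<in> sets borel" for \<sigma>
    using U_open by (induction \<sigma>) auto
  define S where "S n \<sigma> = {t \<in> space M. f n t \<in> cell U \<sigma>}" for n \<sigma>
  have S_sets [measurable]: "S n \<sigma> \<in> sets M" for n \<sigma>
    unfolding S_def by measurable
  have S_tree: "binary_tree (S n)" for n
    by (auto simp: binary_tree_def S_def)
  define \<A> where "\<A> = range (\<lambda>(n, \<sigma>). S n \<sigma>)"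
  define \<G> where "\<G> = sigma_sets (space M) \<A>"
  have \<A>: "countable \<A>" "\<A> \<subseteq> sets M" by (auto simp: \<A>_def)
  interpret relatively_atomless M \<G>
  proof (intro relatively_atomless.intro relatively_atomless_axioms.intro)
    show "finite_measure M" by (rule finite_measure_axioms)
    show "sigma_algebra (space M) \<G>"
      unfolding \<G>_def using \<A>(2) sets.space_closed by (intro sigma_algebra_sigma_sets) blast
    show "\<G> \<subseteq> sets M"
      unfolding \<G>_def using \<A>(2) by (rule sets.sigma_sets_subset)
    show "\<exists>F\<in>sets M. F \<subseteq> A \<and> (\<forall>G\<in>\<G>. measure M ((F - G) \<union> (A \<inter> G - F)) > 0)"
      if "A \<in> sets M" "measure M A > 0" for A
      unfolding \<G>_def by (rule saturated_relatively_atomless[OF sat \<A> that])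
  qed
  have S_\<G>: "S n \<sigma> \<in> \<G>" for n \<sigma>
    unfolding \<G>_def \<A>_def by (intro sigma_sets.Basic) auto
  \<comment> \<open>\<open>X\<close> ranges over a possibly uncountable family, which is why
    convergence is taken along \<open>F\<close> and not along a subsequence.\<close>
  have "\<exists>l. ((\<lambda>n. measure M (S n \<sigma> \<inter> X)) \<longlongrightarrow> l) F" for \<sigma> X
    by (intro F(3) BseqI'[where K="measure M (space M)"]) (simp add: bounded_measure)
  then obtain \<nu> where \<nu>: "\<And>\<sigma> X. ((\<lambda>n. measure M (S n \<sigma> \<inter> X)) \<longlongrightarrow> \<nu> \<sigma> X) F"
    by metis
  have charge_\<nu>: "charge (\<nu> \<sigma>)" for \<sigma>
    unfolding charge_def
  proof (intro conjI exI[of _ 1] ballI impI)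
    fix X assume X: "X \<in> \<G>"
    show "0 \<le> \<nu> \<sigma> X"
      by (rule tendsto_lowerbound[OF \<nu>]) (use F(1) in auto)
    show "\<nu> \<sigma> X \<le> 1 * measure M X"
      by (rule tendsto_upperbound[OF \<nu>]) (use F(1) X in \<open>auto intro!: always_eventually finite_measure_mono\<close>)
    fix Y assume Y: "Y \<in> \<G>" "X \<inter> Y = {}"
    have "measure M (S n \<sigma> \<inter> (X \<union> Y)) = measure M (S n \<sigma> \<inter> X) + measure M (S n \<sigma> \<inter> Y)" for n
      unfolding Int_Un_distrib using X Y by (intro finite_measure_Union) auto
    then show "\<nu> \<sigma> (X \<union> Y) = \<nu> \<sigma> X + \<nu> \<sigma> Y"
      using tendsto_unique[OF F(1) \<nu>[of \<sigma> "X \<union> Y"]] tendsto_add[OF \<nu>[of \<sigma> X] \<nu>[of \<sigma> Y]] by simp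
  qed
  have \<nu>_Nil: "\<nu> [] X = measure M (space M \<inter> X)" for X
  proof -
    have "S n [] = space M" for n by (auto simp: S_def)
    then show ?thesis using tendsto_unique[OF F(1) \<nu>[of "[]" X]] by simp
  qed
  have \<nu>_split: "\<nu> \<sigma> X = \<nu> (True # \<sigma>) X + \<nu> (False # \<sigma>) X" if "X \<in> \<G>" for \<sigma> X
  proof -
    have "measure M (S n \<sigma> \<inter> X) = measure M (S n (True # \<sigma>) \<inter> X) + measure M (S n (False # \<sigma>) \<inter> X)" for n
    proof -
      have eq: "S n \<sigma> \<inter> X = (S n (True # \<sigma>) \<inter> X) \<union> (S n (False # \<sigma>) \<inter> X)"
        and dj: "(S n (True # \<sigma>) \<inter> X) \<inter> (S n (False # \<sigma>) \<inter> X) = {}"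
        by (auto simp: S_def)
      have "S n \<tau> \<inter> X \<in> sets M" for \<tau>
        using S_sets \<G>_in[OF that] by (rule sets.Int)
      then show ?thesis
        unfolding eq using dj by (intro finite_measure_Union)
    qed
    then show ?thesis
      using tendsto_unique[OF F(1) \<nu>[of \<sigma> X]] tendsto_add[OF \<nu>[of "True # \<sigma>" X] \<nu>[of "False # \<sigma>" X]] by simp
  qed
  have \<nu>_nonneg: "X \<in> \<G> \<Longrightarrow> \<nu> \<sigma> X \<ge> 0" for \<sigma> X
    using charge_\<nu> by (auto simp: charge_def)
  \<comment> \<open>The requirement on \<open>D\<close> is a premise, so that \<open>pick\<close> is
    total and \<open>B\<close> can be defined by plain recursion before its properties are
    proved.\<close>
  have "\<exists>C. D \<in> sets M \<and> (\<forall>X\<in>\<G>. measure M (D \<inter> X) = \<nu> \<sigma> X) \<longrightarrow>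
      C \<in> sets M \<and> C \<subseteq> D \<and> (\<forall>X\<in>\<G>. measure M (C \<inter> X) = \<nu> (True # \<sigma>) X)" for D \<sigma>
    using subset_with_conditional_measure[OF _ charge_\<nu>[of "True # \<sigma>"], of D] \<nu>_split \<nu>_nonneg
    by (metis add_increasing2 order_refl)
  then obtain pick where pick: "\<And>D \<sigma>. D \<in> sets M \<Longrightarrow> (\<And>X. X \<in> \<G> \<Longrightarrow> measure M (D \<inter> X) = \<nu> \<sigma> X) \<Longrightarrow>
      pick D \<sigma> \<in> sets M \<and> pick D \<sigma> \<subseteq> D \<and> (\<forall>X\<in>\<G>. measure M (pick D \<sigma> \<inter> X) = \<nu> (True # \<sigma>) X)"
    by metis
  define B where "B = rec_list (space M) (\<lambda>b \<sigma> D. if b then pick D \<sigma> else D - pick D \<sigma>)"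
  have B_simps: "B [] = space M" "B (True # \<sigma>) = pick (B \<sigma>) \<sigma>" "B (False # \<sigma>) = B \<sigma> - pick (B \<sigma>) \<sigma>" for \<sigma>
    by (auto simp: B_def)
  have B: "B \<sigma> \<in> sets M \<and> (\<forall>X\<in>\<G>. measure M (B \<sigma> \<inter> X) = \<nu> \<sigma> X)" for \<sigma>
  proof (induction \<sigma>)
    case Nil
    then show ?case by (simp add: B_simps \<nu>_Nil)
  next
    case (Cons b \<sigma>)
    have D: "B \<sigma> \<in> sets M" "\<And>X. X \<in> \<G> \<Longrightarrow> measure M (B \<sigma> \<inter> X) = \<nu> \<sigma> X"
      using Cons by blast+
    have P: "pick (B \<sigma>) \<sigma> \<in> sets M" "pick (B \<sigma>) \<sigma> \<subseteq> B \<sigma>"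
      "\<And>X. X \<in> \<G> \<Longrightarrow> measure M (pick (B \<sigma>) \<sigma> \<inter> X) = \<nu> (True # \<sigma>) X"
      using pick[OF D] by simp_all
    have "measure M ((B \<sigma> - pick (B \<sigma>) \<sigma>) \<inter> X) = \<nu> (False # \<sigma>) X" if X: "X \<in> \<G>" for X
    proof -
      have "measure M (B \<sigma> \<inter> X - pick (B \<sigma>) \<sigma> \<inter> X) = measure M (B \<sigma> \<inter> X) - measure M (pick (B \<sigma>) \<sigma> \<inter> X)"
        using P(2) by (intro finite_measure_Diff sets.Int D P \<G>_in[OF X] Int_mono order_refl)
      moreover have "(B \<sigma> - pick (B \<sigma>) \<sigma>) \<inter> X = B \<sigma> \<inter> X - pick (B \<sigma>) \<sigma> \<inter> X"
        by blast
      ultimately show ?thesis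
        using D(2)[OF X] P(3)[OF X] \<nu>_split[OF X, of \<sigma>] by simp
    qed
    then show ?case
      using P D by (cases b) (simp_all add: B_simps sets.Diff)
  qed
  have B_sets [measurable]: "B \<sigma> \<in> sets M" for \<sigma> using B by blast
  have B_measure: "measure M (B \<sigma> \<inter> X) = \<nu> \<sigma> X" if "X \<in> \<G>" for \<sigma> X using B that by blast
  have "pick (B \<sigma>) \<sigma> \<subseteq> B \<sigma>" for \<sigma>
    using pick[OF B_sets B_measure] by blast
  then have B_tree: "binary_tree B"
    by (auto simp: binary_tree_def B_simps)
  have "AE t in M. t \<in> B \<sigma> \<longrightarrow> (\<exists>n\<ge>m. f n t \<in> cell U \<sigma>)" for \<sigma> and m :: nat
  proof -
    \<comment> \<open>\<open>X\<close> collects the \<open>t\<close> for which \<open>f n t\<close>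
      avoids the cell for all \<open>n \<ge> m\<close>. As \<open>X\<close> is in \<G>,
      \<open>B \<sigma> \<inter> X\<close> has measure \<open>\<nu> \<sigma> X\<close>, a limit of
      terms that vanish from \<open>m\<close> on.\<close>
    define X where "X = space M - (\<Union>n\<in>{m..}. S n \<sigma>)"
    have X: "X \<in> \<G>"
      unfolding X_def using S_\<G>
      by (intro \<G>_Diff \<G>_space sigma_algebra.countable_UN[OF sigma_\<G>]) auto
    have "eventually (\<lambda>n. n \<ge> m) F"
      using F(2) eventually_ge_at_top[of m] by (auto simp: le_filter_def)
    then have "eventually (\<lambda>n. measure M (S n \<sigma> \<inter> X) = 0) F"
    proof eventually_elim
      case (elim n)
      then have "S n \<sigma> \<inter> X = {}" by (auto simp: X_def)
      then show ?case by simp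
    qed
    then have "((\<lambda>n. measure M (S n \<sigma> \<inter> X)) \<longlongrightarrow> 0) F"
      by (rule tendsto_eventually)
    then have "\<nu> \<sigma> X = 0"
      using tendsto_unique[OF F(1) \<nu>[of \<sigma> X]] by blast
    then have "B \<sigma> \<inter> X \<in> null_sets M"
      using B_measure[OF X, of \<sigma>] X by (auto simp: null_sets_def emeasure_eq_measure)
    then show ?thesis
      by (rule AE_I') (auto simp: X_def S_def)
  qed
  then have "AE t in M. \<forall>\<sigma> m. t \<in> B \<sigma> \<longrightarrow> (\<exists>n\<ge>m. f n t \<in> cell U \<sigma>)"
    unfolding AE_all_countable by blast
  then obtain N where N: "{t \<in> space M. \<not> (\<forall>\<sigma> m. t \<in> B \<sigma> \<longrightarrow> (\<exists>n\<ge>m. f n t \<in> cell U \<sigma>))} \<subseteq> N"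
      "N \<in> null_sets M"
    by (auto elim!: AE_E simp: null_sets_def)
  have "\<exists>l. t \<in> space M - N \<longrightarrow> l \<in> K \<and> (\<forall>m. l \<in> closure ((\<lambda>n. f n t) ` {m..})) \<and>
    (\<forall>\<sigma>. t \<in> B \<sigma> \<longrightarrow> l \<in> closure (K \<inter> cell U \<sigma>)) \<and>
    (\<forall>j. l \<in> U j \<longrightarrow> (\<exists>\<sigma>. t \<in> B \<sigma> \<and> cell U \<sigma> \<subseteq> U j))" for t
  proof (cases "t \<in> space M - N")
    case True
    then have visits: "\<And>\<sigma> m. t \<in> B \<sigma> \<Longrightarrow> \<exists>n\<ge>m. f n t \<in> cell U \<sigma>"
      using N(1) by blast
    have "t \<in> B []" using True by (simp add: B_simps)
    from branch_limit[OF U_open K, of "\<lambda>n. f n t" B t, OF f_K B_tree this visits] True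
    show ?thesis by (metis DiffD1)
  qed blast
  then obtain l where l: "\<And>t. t \<in> space M - N \<Longrightarrow> l t \<in> K"
    "\<And>t m. t \<in> space M - N \<Longrightarrow> l t \<in> closure ((\<lambda>n. f n t) ` {m..})"
    "\<And>t \<sigma>. t \<in> space M - N \<Longrightarrow> t \<in> B \<sigma> \<Longrightarrow> l t \<in> closure (K \<inter> cell U \<sigma>)"
    "\<And>t j. t \<in> space M - N \<Longrightarrow> l t \<in> U j \<Longrightarrow> \<exists>\<sigma>. t \<in> B \<sigma> \<and> cell U \<sigma> \<subseteq> U j"
    by metis
  \<comment> \<open>On the null set any measurable choice with values in \<open>K\<close> does;
    \<open>f 0\<close> is one.\<close>
  define h where "h t = (if t \<in> N then f 0 t else l t)" for t
  have N_sets [measurable]: "N \<in> sets M" using N by auto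
  have AE_N: "AE t in M. t \<notin> N" using N(2) by (rule AE_not_in)
  have h [measurable]: "h \<in> borel_measurable M"
  proof (rule borel_measurableI)
    fix V :: "'b set" assume V: "open V"
    \<comment> \<open>\<open>l t\<close> is only known to be in the closures of the cells of its
      branch, so \<open>U j\<close> must fit into \<open>V\<close> together with its
      closure.\<close>
    define J where "J = {(j, \<sigma>). closure (U j) \<subseteq> V \<and> cell U \<sigma> \<subseteq> U j}"
    define H where "H = (\<Union>(j, \<sigma>)\<in>J. B \<sigma>)"
    have V_iff: "l t \<in> V \<longleftrightarrow> t \<in> H" if t: "t \<in> space M - N" for t
    proof
      assume "l t \<in> V"
      then obtain d where d: "d > 0" "cball (l t) d \<subseteq> V"
        using V open_contains_cball by blast
      obtain j where j: "l t \<in> U j" "U j \<subseteq> ball (l t) d"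
        using topological_basisE[OF U_basis open_ball[of "l t" d], of "l t"] d(1) by auto
      have "closure (U j) \<subseteq> cball (l t) d"
        using j(2) ball_subset_cball by (intro closure_minimal) blast+
      then show "t \<in> H"
        using d(2) l(4)[OF t j(1)] by (auto simp: J_def H_def)
    next
      assume "t \<in> H"
      then obtain j \<sigma> where *: "closure (U j) \<subseteq> V" "cell U \<sigma> \<subseteq> U j" "t \<in> B \<sigma>"
        by (auto simp: J_def H_def)
      have "l t \<in> closure (K \<inter> cell U \<sigma>)" using l(3)[OF t *(3)] .
      also have "\<dots> \<subseteq> closure (U j)" using *(2) by (intro closure_mono) auto
      finally show "l t \<in> V" using *(1) by blast
    qed
    have "h -` V \<inter> space M = (N \<inter> (f 0 -` V \<inter> space M)) \<union> ((space M - N) \<inter> H)"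
    proof (rule set_eqI)
      fix t
      show "t \<in> h -` V \<inter> space M \<longleftrightarrow> t \<in> (N \<inter> (f 0 -` V \<inter> space M)) \<union> ((space M - N) \<inter> H)"
      proof (cases "t \<in> space M - N")
        case True
        then show ?thesis using V_iff[OF True] by (simp add: h_def)
      next
        case False
        then show ?thesis by (auto simp: h_def)
      qed
    qed
    moreover have "f 0 -` V \<inter> space M \<in> sets M"
      using f V by (intro measurable_sets[of _ _ borel]) auto
    moreover have "H \<in> sets M"
      unfolding H_def by (intro sets.countable_UN') auto
    ultimately show "h -` V \<inter> space M \<in> sets M" by simp
  qed
  have h_K: "h t \<in> K" if "t \<in> space M" for t
    using that l(1) f_K by (auto simp: h_def)
  show thesis
  proof
    show "h \<in> borel_measurable M" by fact
    show "h \<in> space M \<rightarrow> K" using h_K by blast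
    show "AE t in M. \<forall>m. h t \<in> closure ((\<lambda>n. f n t) ` {m..})"
      using AE_N AE_space[of M]
    proof eventually_elim
      case (elim t)
      then show ?case using l(2)[of t] by (simp add: h_def)
    qed
    show "\<forall>c :: 'b \<Rightarrow> real. continuous_on K c \<longrightarrow> ((\<lambda>n. \<integral>t. c (f n t) \<partial>M) \<longlongrightarrow> (\<integral>t. c (h t) \<partial>M)) F"
    proof (intro allI impI)
      fix c :: "'b \<Rightarrow> real" assume c: "continuous_on K c"
      have c_meas: "(\<lambda>t. c (g t)) \<in> borel_measurable M"
        if "g \<in> borel_measurable M" "\<And>t. t \<in> space M \<Longrightarrow> g t \<in> K" for g
        by (rule measurable_compose[OF measurable_restrict_space2 borel_measurable_continuous_on_restrict[OF c]])
          (use that in auto)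
      show "((\<lambda>n. \<integral>t. c (f n t) \<partial>M) \<longlongrightarrow> (\<integral>t. c (h t) \<partial>M)) F"
      proof (rule tendstoI)
        fix e :: real assume e: "e > 0"
        \<comment> \<open>Each of the two integral estimates costs at most \<open>e / 4\<close>,
          which leaves \<open>e / 2\<close> for the sums over level \<open>k\<close>; the added 1
          covers a space of measure zero.\<close>
        define \<epsilon> where "\<epsilon> = e / (4 * (measure M (space M) + 1))"
        have \<epsilon>: "\<epsilon> > 0" using e by (simp add: \<epsilon>_def add_nonneg_pos)
        have \<epsilon>_le: "\<epsilon> * measure M (space M) \<le> e / 4"
        proof -
          have "\<epsilon> * (measure M (space M) + 1) = e / 4"
          proof -
            have "measure M (space M) + 1 \<noteq> 0" using measure_nonneg[of M "space M"] by linarith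
            moreover have "e / (4 * m) * m = e / 4" if "m \<noteq> 0" for m
              using that by simp
            ultimately show ?thesis unfolding \<epsilon>_def by blast
          qed
          moreover have "\<epsilon> * (measure M (space M) + 1) = \<epsilon> * measure M (space M) + \<epsilon>"
            by (simp add: algebra_simps)
          ultimately show ?thesis using \<epsilon> by linarith
        qed
        obtain k where k: "\<And>\<sigma> x y. length \<sigma> = k \<Longrightarrow> x \<in> K \<inter> cell U \<sigma> \<Longrightarrow> y \<in> K \<inter> cell U \<sigma> \<Longrightarrow> \<bar>c x - c y\<bar> < \<epsilon>"
          using cell_small_oscillation[OF U_basis K c \<epsilon>] by blast
        \<comment> \<open>If \<open>K\<close> misses the cell the value is arbitrary, but then no
          point is subject to the two bounds below.\<close>
        define a where "a \<sigma> = c (SOME x. x \<in> K \<inter> cell U \<sigma>)" for \<sigma>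
        have a: "\<bar>c x - a \<sigma>\<bar> \<le> \<epsilon>" if "length \<sigma> = k" "x \<in> K \<inter> cell U \<sigma>" for \<sigma> x
          using k[OF that] someI[of "\<lambda>x. x \<in> K \<inter> cell U \<sigma>", OF that(2)] by (force simp: a_def)
        have a': "\<bar>c x - a \<sigma>\<bar> \<le> \<epsilon>" if \<sigma>: "length \<sigma> = k" and x: "x \<in> K" "x \<in> closure (K \<inter> cell U \<sigma>)" for \<sigma> x
        proof -
          obtain y where y: "\<And>i. y i \<in> K \<inter> cell U \<sigma>" "y \<longlonglongrightarrow> x"
            using x(2) unfolding closure_sequential by blast
          have "(\<lambda>i. c (y i)) \<longlonglongrightarrow> c x"
            by (rule continuous_on_tendsto_compose[OF c y(2) x(1)]) (use y in auto)
          then have "(\<lambda>i. \<bar>c (y i) - a \<sigma>\<bar>) \<longlonglongrightarrow> \<bar>c x - a \<sigma>\<bar>"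
            by (intro tendsto_intros)
          then show ?thesis
            by (rule LIMSEQ_le_const2) (use a[OF \<sigma> y(1)] in auto)
        qed
        have 1: "\<bar>(\<integral>t. c (f n t) \<partial>M) - (\<Sum>\<sigma> | length \<sigma> = k. a \<sigma> * measure M (S n \<sigma>))\<bar> \<le> \<epsilon> * measure M (space M)" for n
        proof (rule binary_tree_integral[OF S_tree])
          show "S n [] = space M" by (auto simp: S_def)
          show "AE t in M. \<forall>\<sigma>. length \<sigma> = k \<longrightarrow> t \<in> S n \<sigma> \<longrightarrow> \<bar>c (f n t) - a \<sigma>\<bar> \<le> \<epsilon>"
            by (rule AE_I2) (use a f_K in \<open>auto simp: S_def\<close>)
        qed (use c_meas f f_K in auto)
        have 2: "\<bar>(\<integral>t. c (h t) \<partial>M) - (\<Sum>\<sigma> | length \<sigma> = k. a \<sigma> * measure M (B \<sigma>))\<bar> \<le> \<epsilon> * measure M (space M)"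
        proof (rule binary_tree_integral[OF B_tree])
          show "AE t in M. \<forall>\<sigma>. length \<sigma> = k \<longrightarrow> t \<in> B \<sigma> \<longrightarrow> \<bar>c (h t) - a \<sigma>\<bar> \<le> \<epsilon>"
            using AE_N AE_space[of M]
          proof eventually_elim
            case (elim t)
            then show ?case using a' l(1)[of t] l(3)[of t] by (simp add: h_def)
          qed
        qed (use c_meas h h_K B_simps in auto)
        have "((\<lambda>n. measure M (S n \<sigma>)) \<longlongrightarrow> measure M (B \<sigma>)) F" for \<sigma>
        proof -
          have "S n \<sigma> \<inter> space M = S n \<sigma>" for n by (auto simp: S_def)
          moreover have "B \<sigma> \<inter> space M = B \<sigma>" using sets.sets_into_space[OF B_sets] by auto
          ultimately show ?thesis
            using \<nu>[of \<sigma> "space M"] B_measure[OF \<G>_space, of \<sigma>] by simp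
        qed
        then have "((\<lambda>n. \<Sum>\<sigma> | length \<sigma> = k. a \<sigma> * measure M (S n \<sigma>)) \<longlongrightarrow>
            (\<Sum>\<sigma> | length \<sigma> = k. a \<sigma> * measure M (B \<sigma>))) F"
          by (intro tendsto_intros)
        then have "\<forall>\<^sub>F n in F. dist (\<Sum>\<sigma> | length \<sigma> = k. a \<sigma> * measure M (S n \<sigma>))
            (\<Sum>\<sigma> | length \<sigma> = k. a \<sigma> * measure M (B \<sigma>)) < e / 2"
          using e by (intro tendstoD) auto
        then show "\<forall>\<^sub>F n in F. dist (\<integral>t. c (f n t) \<partial>M) (\<integral>t. c (h t) \<partial>M) < e"
        proof eventually_elim
          case (elim n)
          then show ?case
            using 1[of n] 2 \<epsilon>_le unfolding dist_real_def by linarith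
        qed
      qed
    qed
  qed
qed

subsection \<open>Pareto optimal allocations\<close>

text \<open>The topology is the pullback of a product topology along \<open>blinfun_apply\<close>,
  where convergence is coordinatewise. A general filter is allowed because the limits of integrals
  are taken along one.\<close>

lemma limitin_weak_star:
  assumes "\<And>x. ((\<lambda>n. blinfun_apply (J n) x) \<longlongrightarrow> blinfun_apply L x) F"
  shows "limitin weak_star J L F"
proof -
  have "limitin (product_topology (\<lambda>_. euclidean) UNIV) (\<lambda>n. blinfun_apply (J n)) (blinfun_apply L) F"
    using assms by (simp add: limitin_componentwise)
  then have lim: "((\<lambda>n. blinfun_apply (J n)) \<longlongrightarrow> blinfun_apply L) F"
    by (simp add: euclidean_product_topology)
  show ?thesis
    unfolding limitin_def
  proof (intro conjI allI impI)
    show "L \<in> topspace weak_star"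
      by (simp add: strong_operator_topology_topspace)
    fix V assume V: "openin weak_star V \<and> L \<in> V"
    then obtain O' where O': "open O'" "V = blinfun_apply -` O'"
      by (auto simp: strong_operator_topology_def openin_pullback_topology)
    then have "eventually (\<lambda>n. blinfun_apply (J n) \<in> O') F"
      using V by (intro topological_tendstoD[OF lim]) auto
    then show "eventually (\<lambda>n. J n \<in> V) F"
      using O' by simp
  qed
qed

theorem theorem5p3:
  fixes M :: "'a measure"
    and W X :: "('e::banach \<Rightarrow>\<^sub>L real) set"
    and pref :: "'a \<Rightarrow> (('e \<Rightarrow>\<^sub>L real) \<times> ('e \<Rightarrow>\<^sub>L real)) set"
    and \<omega> :: "'a \<Rightarrow> 'e \<Rightarrow>\<^sub>L real"
  assumes "finite_measure M" and "complete_measure M" and "saturated_measure M"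
    and "separable_space (euclidean :: 'e topology)"
    and "W \<noteq> {}" and "closedin weak_star W"
    and "economy M X pref \<omega>"
    and "allocations M W X \<omega> \<noteq> {}"
    and "compactin weak_star X"
    and "\<And>t. t \<in> space M \<Longrightarrow>
           closedin (subtopology (prod_topology weak_star weak_star) (X \<times> X)) (pref t)"
    and "\<And>x y. x \<in> X \<Longrightarrow> y \<in> X \<Longrightarrow>
           {t \<in> space M. strictly_prefers (pref t) x y} \<in> sets M"
  shows "pareto_optimal_allocations M W X pref \<omega> \<noteq> {}"
proof -
  interpret finite_measure M by fact
  note sat = assms(3) and W = assms(6) and econ = assms(7) and alloc_ne = assms(8) and X = assms(9)
    and pref_closed = assms(10) and pref_sets = assms(11)
  have pref_sub: "pref t \<subseteq> X \<times> X" and pref_complete: "x \<in> X \<Longrightarrow> y \<in> X \<Longrightarrow> (x, y) \<in> pref t \<or> (y, x) \<in> pref t"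
    and pref_trans: "trans (pref t)" if "t \<in> space M" for t x y
    using econ that by (auto simp: economy_def)
  have \<omega>: "gelfand_integrable M \<omega>" "\<And>t. t \<in> space M \<Longrightarrow> \<omega> t \<in> X"
    using econ by (auto simp: economy_def)
  obtain E :: "'e set" where E: "countable E" "closure E = UNIV"
    using assms(4) by (auto simp: separable_space_def)
  then have "E \<noteq> {}" by auto
  define e where "e = from_nat_into E"
  have e: "range e = E"
    using E(1) \<open>E \<noteq> {}\<close> by (simp add: e_def range_from_nat_into)
  \<comment> \<open>Evaluation at a dense sequence is injective and carries \<open>X\<close>
    homeomorphically onto a compact subset of \<open>nat \<Rightarrow> real\<close>, a metric space
    with a countable basis, as the selection theorems require.\<close>
  define \<Phi> :: "('e \<Rightarrow>\<^sub>L real) \<Rightarrow> nat \<Rightarrow> real" where "\<Phi> p = (\<lambda>i. blinfun_apply p (e i))" for p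
  have \<Phi>_eqD: "p = q" if "\<Phi> p = \<Phi> q" for p q
  proof (rule blinfun_eqI)
    fix x
    have "x \<in> closure E" using E by simp
    moreover have "E \<subseteq> {x. blinfun_apply p x = blinfun_apply q x}"
      using that e by (auto simp: \<Phi>_def fun_eq_iff)
    moreover have "closed {x. blinfun_apply p x = blinfun_apply q x}"
      by (intro closed_Collect_eq continuous_intros)
    ultimately show "blinfun_apply p x = blinfun_apply q x"
      using closure_minimal[of E] by blast
  qed
  have eval_cont: "continuous_map weak_star euclidean (\<lambda>p. blinfun_apply p x)" for x :: 'e
    by (rule strong_operator_topology_continuous_evaluation)
  have \<Phi>_cont: "continuous_map weak_star euclidean \<Phi>"
  proof -
    have "continuous_map weak_star (product_topology (\<lambda>_. euclidean) UNIV) \<Phi>"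
      unfolding continuous_map_componentwise_UNIV \<Phi>_def using eval_cont by auto
    then show ?thesis by (simp add: euclidean_product_topology)
  qed
  define K where "K = \<Phi> ` X"
  have K: "compact K"
    using image_compactin[OF X \<Phi>_cont] by (simp add: K_def)
  define \<Psi> where "\<Psi> = inv_into X \<Phi>"
  have \<Psi>: "\<Psi> k \<in> X" "\<Phi> (\<Psi> k) = k" if "k \<in> K" for k
    using that by (auto simp: K_def \<Psi>_def inv_into_into f_inv_into_f)
  have \<Psi>_\<Phi>: "\<Psi> (\<Phi> p) = p" if "p \<in> X" for p
    using \<Psi>[of "\<Phi> p"] that \<Phi>_eqD by (auto simp: K_def)
  \<comment> \<open>A continuous bijection from a compact onto a Hausdorff space has a continuous
    inverse; this gives continuity on \<open>K\<close> of every evaluation, not only of those at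
    \<open>e i\<close>.\<close>
  have \<Psi>_cont: "continuous_on K (\<lambda>k. blinfun_apply (\<Psi> k) x)" for x
    unfolding continuous_on_closed_vimage[OF compact_imp_closed[OF K]]
  proof (intro allI impI)
    fix C :: "real set" assume "closed C"
    then have "closedin weak_star {p \<in> topspace weak_star. blinfun_apply p x \<in> C}"
      using eval_cont[of x] by (auto simp: continuous_map_closedin)
    then have "compactin weak_star (X \<inter> {p \<in> topspace weak_star. blinfun_apply p x \<in> C})"
      by (intro compact_Int_closedin X)
    from image_compactin[OF this \<Phi>_cont]
    have "closed (\<Phi> ` (X \<inter> {p. blinfun_apply p x \<in> C}))"
      by (auto simp: strong_operator_topology_topspace intro: compact_imp_closed)
    moreover have "\<Phi> ` (X \<inter> {p. blinfun_apply p x \<in> C}) = (\<lambda>k. blinfun_apply (\<Psi> k) x) -` C \<inter> K"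
      using \<Psi> \<Psi>_\<Phi> by (force simp: K_def)
    ultimately show "closed ((\<lambda>k. blinfun_apply (\<Psi> k) x) -` C \<inter> K)" by simp
  qed
  have \<Psi>_bounded: "\<exists>b. \<forall>k\<in>K. \<bar>blinfun_apply (\<Psi> k) x\<bar> \<le> b" for x
    using compact_imp_bounded[OF compact_continuous_image[OF \<Psi>_cont[of x] K]]
    by (auto simp: bounded_iff)
  have \<Psi>_gelfand: "gelfand_integrable M (\<lambda>t. \<Psi> (h t))"
    if h: "h \<in> borel_measurable M" "\<And>t. t \<in> space M \<Longrightarrow> h t \<in> K" for h
    unfolding gelfand_integrable_def
  proof
    fix x
    obtain b where "\<And>k. k \<in> K \<Longrightarrow> \<bar>blinfun_apply (\<Psi> k) x\<bar> \<le> b"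
      using \<Psi>_bounded by blast
    moreover have "(\<lambda>t. blinfun_apply (\<Psi> (h t)) x) \<in> borel_measurable M"
      by (rule measurable_compose[OF measurable_restrict_space2 borel_measurable_continuous_on_restrict[OF \<Psi>_cont[of x]]])
        (use h in auto)
    ultimately show "integrable M (\<lambda>t. blinfun_apply (\<Psi> (h t)) x)"
      using h(2) by (intro integrable_const_bound[where B=b]) auto
  qed
  have \<Phi>_meas: "(\<lambda>t. \<Phi> (f t)) \<in> borel_measurable M" if "gelfand_integrable M f" for f
    unfolding \<Phi>_def using that
    by (intro measurable_coordinatewise_then_product) (auto simp: gelfand_integrable_def)
  define R where "R t = map_prod \<Phi> \<Phi> ` pref t" for t
  have R_iff: "(\<Phi> p, \<Phi> q) \<in> R t \<longleftrightarrow> (p, q) \<in> pref t" for p q t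
    unfolding R_def by (auto dest!: \<Phi>_eqD)
  interpret measurable_preferences M K R
  proof
    show "closed (R t)" if t: "t \<in> space M" for t
    proof -
      have "compactin (prod_topology weak_star weak_star) (X \<times> X)"
        using X by (simp add: compactin_Times)
      then have "compactin (prod_topology weak_star weak_star) (pref t)"
        using pref_closed[OF t] closedin_compact_space compactin_subspace
        by (metis compactin_subtopology)
      moreover have "continuous_map (prod_topology weak_star weak_star) (prod_topology euclidean euclidean) (map_prod \<Phi> \<Phi>)"
        unfolding map_prod_def continuous_map_prod_top using \<Phi>_cont by blast
      ultimately have "compactin (prod_topology euclidean euclidean) (R t)"
        unfolding R_def by (rule image_compactin)
      then show ?thesis by (simp add: euclidean_product_topology prod_topology_euclidean compact_imp_closed)
    qed
    show "(x, y) \<in> R t \<or> (y, x) \<in> R t" if t: "t \<in> space M" and xy: "x \<in> K" "y \<in> K" for t x y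
    proof -
      obtain p q where "x = \<Phi> p" "y = \<Phi> q" "p \<in> X" "q \<in> X"
        using xy by (auto simp: K_def)
      then show ?thesis using pref_complete[OF t, of p q] by (simp add: R_iff)
    qed
    show "trans (R t)" if "t \<in> space M" for t
    proof (rule transI)
      fix x y z assume xy: "(x, y) \<in> R t" and yz: "(y, z) \<in> R t"
      obtain p q where p: "x = \<Phi> p" "y = \<Phi> q" "(p, q) \<in> pref t"
        using xy by (auto simp: R_def)
      obtain q' r where q': "y = \<Phi> q'" "z = \<Phi> r" "(q', r) \<in> pref t"
        using yz by (auto simp: R_def)
      have "q = q'" using \<Phi>_eqD p q' by simp
      then have "(p, r) \<in> pref t" using transD[OF pref_trans[OF that]] p q' by blast
      then show "(x, z) \<in> R t" using p q' R_iff by simp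
    qed
    show "{t \<in> space M. (x, y) \<in> R t} \<in> sets M" if xy: "x \<in> K" "y \<in> K" for x y
    proof -
      obtain p q where *: "x = \<Phi> p" "y = \<Phi> q" "p \<in> X" "q \<in> X"
        using xy by (auto simp: K_def)
      \<comment> \<open>By completeness the weak relation is the complement of the reversed strict
        one.\<close>
      have "{t \<in> space M. (x, y) \<in> R t} = space M - {t \<in> space M. strictly_prefers (pref t) q p}"
        using pref_complete[OF _ *(3,4)] by (auto simp: *(1,2) R_iff strictly_prefers_def)
      then show ?thesis using pref_sets[OF *(4,3)] by simp
    qed
  qed
  define \<A> where "\<A> = (\<lambda>f t. \<Phi> (f t)) ` allocations M W X \<omega>"
  have "\<exists>f\<in>\<A>. \<forall>g\<in>\<A>. \<forall>A\<in>sets M. (AE t in M. (g t, f t) \<in> R t) \<longrightarrow>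
    (\<forall>t\<in>A. (f t, g t) \<notin> R t) \<longrightarrow> measure M A = 0"
  proof (rule maximal_selection)
    show "\<A> \<noteq> {}" using alloc_ne by (simp add: \<A>_def)
    show "f \<in> borel_measurable M" if "f \<in> \<A>" for f
      using that \<Phi>_meas by (auto simp: \<A>_def allocations_def)
    show "AE t in M. f t \<in> K" if "f \<in> \<A>" for f
      using that by (auto simp: \<A>_def allocations_def K_def elim: eventually_mono)
    fix s :: "nat \<Rightarrow> 'a \<Rightarrow> nat \<Rightarrow> real" assume s: "\<And>n. s n \<in> \<A>"
    then have "\<forall>n. \<exists>f\<in>allocations M W X \<omega>. s n = (\<lambda>t. \<Phi> (f t))"
      by (auto simp: \<A>_def)
    then obtain f where f: "\<And>n. f n \<in> allocations M W X \<omega>" "\<And>n. s n = (\<lambda>t. \<Phi> (f n t))"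
      by metis
    have f_int: "gelfand_integrable M (f n)" and f_W: "gelfand_integral M (f n) - gelfand_integral M \<omega> \<in> W"
      and f_X: "AE t in M. f n t \<in> X" for n
      using f(1)[of n] by (auto simp: allocations_def)
    have "AE t in M. \<forall>n. f n t \<in> X"
      using f_X by (simp add: AE_all_countable)
    then obtain N where N: "{t \<in> space M. \<not> (\<forall>n. f n t \<in> X)} \<subseteq> N" "N \<in> null_sets M"
      by (auto elim!: AE_E simp: null_sets_def)
    have AE_N: "AE t in M. t \<notin> N" by (rule AE_not_in[OF N(2)])
    \<comment> \<open>The endowment is the default on the null set: it has values in
      \<open>X\<close> at every agent and keeps the composition with \<Phi> measurable.\<close>
    define f' where "f' n t = (if t \<in> N then \<omega> t else f n t)" for n t
    have f'_X: "f' n t \<in> X" if "t \<in> space M" for n t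
      using that N(1) \<omega>(2) by (auto simp: f'_def)
    have f'_meas: "(\<lambda>t. \<Phi> (f' n t)) \<in> borel_measurable M" for n
    proof -
      have "(\<lambda>t. if t \<in> N then \<Phi> (\<omega> t) else \<Phi> (f n t)) \<in> borel_measurable M"
        using N(2) \<Phi>_meas[OF \<omega>(1)] \<Phi>_meas[OF f_int]
        by (intro measurable_If_set) (auto simp: null_sets_def sets.Int_space_eq2)
      moreover have "(\<lambda>t. \<Phi> (f' n t)) = (\<lambda>t. if t \<in> N then \<Phi> (\<omega> t) else \<Phi> (f n t))"
        by (auto simp: f'_def)
      ultimately show ?thesis by simp
    qed
    obtain F :: "nat filter" where F: "F \<noteq> bot" "F \<le> sequentially"
      "\<And>s :: nat \<Rightarrow> real. Bseq s \<Longrightarrow> \<exists>l. (s \<longlongrightarrow> l) F"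
      using bounded_convergence_filter by blast
    have f'_K: "\<Phi> (f' n t) \<in> K" if "t \<in> space M" for n t
      using f'_X[OF that] by (simp add: K_def)
    obtain h where h_meas: "h \<in> borel_measurable M" and h_K: "h \<in> space M \<rightarrow> K"
      and h_closure: "AE t in M. \<forall>m. h t \<in> closure ((\<lambda>n. \<Phi> (f' n t)) ` {m..})"
      and h_lim: "\<forall>c :: (nat \<Rightarrow> real) \<Rightarrow> real. continuous_on K c \<longrightarrow>
        ((\<lambda>n. \<integral>t. c (\<Phi> (f' n t)) \<partial>M) \<longlongrightarrow> (\<integral>t. c (h t) \<partial>M)) F"
      by (rule saturated_limit_selection[OF sat K f'_meas f'_K F])
    have h_in: "h t \<in> K" if "t \<in> space M" for t
      using h_K that by blast
    define g where "g t = \<Psi> (h t)" for t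
    have g_int: "gelfand_integrable M g"
      unfolding g_def by (rule \<Psi>_gelfand[OF h_meas h_in])
    \<comment> \<open>The test function is \<open>blinfun_apply (\<Psi> k) x\<close> as a function
      of \<open>k\<close>; one such function for each \<open>x\<close> turns limits of integrals
      into weak-star limits of Gelfand integrals.\<close>
    have lim: "((\<lambda>n. blinfun_apply (gelfand_integral M (f n)) x) \<longlongrightarrow> blinfun_apply (gelfand_integral M g) x) F" for x
    proof -
      have "(\<integral>t. blinfun_apply (\<Psi> (\<Phi> (f' n t))) x \<partial>M) = (\<integral>t. blinfun_apply (f n t) x \<partial>M)" for n
      proof (rule integral_cong_AE)
        show "(\<lambda>t. blinfun_apply (\<Psi> (\<Phi> (f' n t))) x) \<in> borel_measurable M"
          using \<Psi>_gelfand[OF f'_meas[of n]] f'_X by (auto simp: gelfand_integrable_def K_def)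
        show "(\<lambda>t. blinfun_apply (f n t) x) \<in> borel_measurable M"
          using f_int[of n] by (auto simp: gelfand_integrable_def)
        show "AE t in M. blinfun_apply (\<Psi> (\<Phi> (f' n t))) x = blinfun_apply (f n t) x"
          using AE_N AE_space[of M]
        proof eventually_elim
          case (elim t)
          then show ?case using \<Psi>_\<Phi>[OF f'_X[of t n]] by (simp add: f'_def)
        qed
      qed
      then show ?thesis
        using h_lim[rule_format, OF \<Psi>_cont[of x]]
        by (simp add: gelfand_integral_apply[OF f_int] gelfand_integral_apply[OF g_int] g_def)
    qed
    have "limitin weak_star (\<lambda>n. gelfand_integral M (f n) - gelfand_integral M \<omega>)
        (gelfand_integral M g - gelfand_integral M \<omega>) F"
      by (rule limitin_weak_star) (auto simp: blinfun.diff_left intro!: tendsto_diff lim)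
    then have "gelfand_integral M g - gelfand_integral M \<omega> \<in> W"
      by (rule limitin_closedin[OF _ W]) (use f_W F(1) in auto)
    moreover have "AE t in M. g t \<in> X"
      using \<Psi> h_in by (intro AE_I2) (auto simp: g_def)
    ultimately have "g \<in> allocations M W X \<omega>"
      using g_int by (simp add: allocations_def)
    then have "(\<lambda>t. \<Phi> (g t)) \<in> \<A>" by (auto simp: \<A>_def)
    moreover have "AE t in M. \<forall>m. \<Phi> (g t) \<in> closure ((\<lambda>n. s n t) ` {m..})"
      using h_closure AE_N AE_space[of M]
    proof eventually_elim
      case (elim t)
      have g_h: "\<Phi> (g t) = h t" using \<Psi>(2)[OF h_in] elim by (simp add: g_def)
      have s_f': "(\<lambda>n. s n t) = (\<lambda>n. \<Phi> (f' n t))"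
        using elim by (auto simp: f(2) f'_def)
      show ?case unfolding g_h s_f' by (rule elim(1))
    qed
    ultimately show "\<exists>f\<in>\<A>. AE t in M. \<forall>m. f t \<in> closure ((\<lambda>n. s n t) ` {m..})"
      by (intro bexI[of _ "\<lambda>t. \<Phi> (g t)"])
  qed
  then obtain f where f: "f \<in> allocations M W X \<omega>"
    and max: "\<And>g A. g \<in> allocations M W X \<omega> \<Longrightarrow> A \<in> sets M \<Longrightarrow> AE t in M. (g t, f t) \<in> pref t \<Longrightarrow>
      (\<forall>t\<in>A. (f t, g t) \<notin> pref t) \<Longrightarrow> measure M A = 0"
    unfolding \<A>_def by (auto simp: R_iff)
  have "f \<in> pareto_optimal_allocations M W X pref \<omega>"
    unfolding pareto_optimal_allocations_def strictly_prefers_def using f max by fastforce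
  then show ?thesis by blast
qed

end
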